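(* Let $\ell>0$, let $C_\ell$ be the hyperbolic cylinder with central geodesic of (primitive) length $\ell$, and fix a Schottky data for $C_\ell$, consisting of open Euclidean disks $\mathcal{D}_1,\mathcal{D}_{-1}$ and a generator $S_1$ (with $S_{-1}=S_1^{-1}$). For $s\in\mathbb{C}$ let $\mathcal{L}_{C_\ell,s}\colon\mathcal{H}\to\mathcal{H}$ be the associated transfer operator. Then $1$ is an eigenvalue of $\mathcal{L}_{C_\ell,s}$ if and only if $s\in-\mathbb{N}_0+\frac{2\pi i}{\ell}\mathbb{Z}$. In this case, the geometric multiplicity of the eigenvalue $1$ is $2$. Moreover, let $p\in\mathrm{PSL}_2(\mathbb{R})$ be such that $S_1=p\,a_\ell\,p^{-1}$, and let $n\in\mathbb{N}_0$ and $s\in-n+\frac{2\pi i}{\ell}\mathbb{Z}$. Then the eigenspace of $\mathcal{L}_{C_\ell,s}$ in $\mathcal{H}$ for the eigenvalue $1$ is spanned by the two functions $$\bigl(\tau_s(p)z^n,\ 0\bigr)\quad\text{and}\quad\bigl(0,\ \tau_s(pS)z^n\bigr),$$ where $S\in\mathrm{PSL}_2(\mathbb{R})$ is the element represented by $\begin{pmatrix}0&1\\-1&0\end{pmatrix}$.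
   Context: $\mathbb{N}_0=\{0,1,2,\dots\}$, $\widehat{\mathbb{C}}=\mathbb{C}\cup\{\infty\}$, and $\mathrm{PSL}_2(\mathbb{R})$ acts on $\widehat{\mathbb{C}}$ by fractional linear transformations $g.z$. For $L>0$, $a_L\in\mathrm{PSL}_2(\mathbb{R})$ is the element represented by $\begin{pmatrix}e^{L/2}&0\\0&e^{-L/2}\end{pmatrix}$, so $a_L.z=e^Lz$. The cylinder $C_\ell$ is isometric to $\langle a_\ell\rangle\backslash\mathbb{H}$, with $\mathbb{H}$ the upper half plane with the hyperbolic metric. Schottky data. A subset of $\widehat{\mathbb{C}}$ is a Euclidean disk if some element of $\mathrm{PSL}_2(\mathbb{R})$ maps it to a Euclidean disk in $\mathbb{C}$ in the usual sense. A Schottky data for $C_\ell$ consists of two open Euclidean disks $\mathcal{D}_1,\mathcal{D}_{-1}\subseteq\widehat{\mathbb{C}}$, centered on $\mathbb{R}\cup\{\infty\}$ and with disjoint closures, and an element $S_1\in\mathrm{PSL}_2(\mathbb{R})$ mapping the exterior of $\mathcal{D}_1$ to the interior of $\mathcal{D}_{-1}$, such that $\langle S_1\rangle\backslash\mathbb{H}$ is isometric to $C_\ell$. Then $S_1$ is conjugate in $\mathrm{PSL}_2(\mathbb{R})$ to $a_\ell$; its repelling fixed point lies in $\mathcal{D}_1$ and its attracting fixed point in $\mathcal{D}_{-1}$. The operators $\tau_s$. For $s\in\mathbb{C}$ and $g\in\mathrm{PSL}_2(\mathbb{R})$ represented by $\begin{pmatrix}a&b\\c&d\end{pmatrix}$,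 set on real points $$\tau_s(g^{-1})f(x)=\bigl(g'(x)\bigr)^sf(g.x)=|cx+d|^{-2s}f\Bigl(\frac{ax+b}{cx+d}\Bigr).$$ If $D,D'\subset\mathbb{C}$ are bounded open disks centered on $\mathbb{R}$ with $g.D\subseteq D'$, this extends to holomorphic functions $f$ on $D'$ by $\tau_s(g^{-1})f(z)=(g'(z))^sf(g.z)$ for $z\in D$, where $(g'(z))^s$ is the holomorphic branch on $D$ equal to $|cx+d|^{-2s}$ at real $x\in D$. With this convention $\tau_s(gh)=\tau_s(g)\tau_s(h)$ wherever both sides are defined. Function spaces. For a bounded open disk $D\subset\mathbb{C}$, $H^2(D)$ is the Hilbert Bergman space of holomorphic functions on $D$ that are square-integrable with respect to Lebesgue measure. If $D\subset\widehat{\mathbb{C}}$ is a Euclidean disk not bounded in $\mathbb{C}$, choose $q\in\mathrm{PSL}_2(\mathbb{R})$ such that $q.D$ is a bounded disk in $\mathbb{C}$; a function $f$ is said to belong to $H^2(D)$ if $\tau_s(q)f\in H^2(q.D)$, i.e. $H^2(D)$ is identified with $H^2(q.D)$ via $\tau_s(q)$, and all operators $\tau_s(g)$ are understood through this identification (the choice of $q$ is immaterial). The function $z^n$ is considered on $p^{-1}.\mathcal{D}_1$ for $\tau_s(p)z^n\in H^2(\mathcal{D}_1)$ and on $(pS)^{-1}.\mathcal{D}_{-1}$ for $\tau_s(pS)z^n\in H^2(\mathcal{D}_{-1})$; both sets are bounded disks containing $0$. Transfer operator. $\mathcal{H}=H^2(\mathcal{D}_1)\oplus H^2(\mathcal{D}_{-1})$,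 with elements written $(f_1,f_{-1})$, and $$\mathcal{L}_{C_\ell,s}=\begin{pmatrix}\tau_s(S_1)&0\\0&\tau_s(S_1^{-1})\end{pmatrix}\colon\mathcal{H}\to\mathcal{H}.$$ *)

theory Defs
  imports
    "HOL-Complex_Analysis.Complex_Analysis"
    "HOL-Library.Function_Algebras"
begin

unbundle no Formal_Power_Series.fps_syntax

section \<open>The group \<open>PSL\<^sub>2(\<real>)\<close>\<close>

definition psl2_rel :: "real^2^2 \<Rightarrow> real^2^2 \<Rightarrow> bool" where
  "psl2_rel A B \<longleftrightarrow> det A = 1 \<and> det B = 1 \<and> (A = B \<or> A = - B)"

lemma det_uminus_2 [simp]: "det (- A) = det (A :: real^2^2)"
  by (simp add: det_2)

lemma psl2_rel_part_equivp: "part_equivp psl2_rel"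
proof (rule part_equivpI)
  show "\<exists>A. psl2_rel A A"
    by (rule exI[of _ "mat 1"]) (simp add: psl2_rel_def)
  show "symp psl2_rel"
    by (auto simp: symp_def psl2_rel_def)
  show "transp psl2_rel"
    by (auto simp: transp_def psl2_rel_def)
qed

quotient_type psl2 = "real^2^2" / partial: psl2_rel
  by (rule psl2_rel_part_equivp)

lemma matrix_mul_uminus:
  fixes A B :: "real^2^2"
  shows "(- A) ** B = - (A ** B)" "A ** (- B) = - (A ** B)"
  by (simp_all add: vec_eq_iff matrix_matrix_mult_def sum_negf)

lemma matrix_inv_det_1:
  assumes "det (A :: real^2^2) = 1"
  shows "A ** matrix_inv A = mat 1" "matrix_inv A ** A = mat 1"
proof -
  have "invertible A"
    using assms by (simp add: invertible_det_nz)
  then have "A ** matrix_inv A = mat 1 \<and> matrix_inv A ** A = mat 1"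
    unfolding invertible_def matrix_inv_def by (rule someI_ex)
  then show "A ** matrix_inv A = mat 1" "matrix_inv A ** A = mat 1"
    by auto
qed

lemma matrix_inv_uminus:
  assumes "det (A :: real^2^2) = 1"
  shows "matrix_inv (- A) = - matrix_inv A"
proof -
  have "matrix_inv (- A) = matrix_inv (- A) ** (A ** matrix_inv A)"
    using assms by (simp add: matrix_inv_det_1)
  also have "\<dots> = - ((matrix_inv (- A) ** (- A)) ** matrix_inv A)"
    by (simp add: matrix_mul_assoc matrix_mul_uminus)
  also have "\<dots> = - matrix_inv A"
    using assms by (simp add: matrix_inv_det_1)
  finally show ?thesis .
qed

lemma det_matrix_inv: "det (A :: real^2^2) = 1 \<Longrightarrow> det (matrix_inv A) = 1"
  by (metis det_I det_mul matrix_inv_det_1(1) mult_1)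

instantiation psl2 :: "{monoid_mult, inverse}"
begin

lift_definition one_psl2 :: psl2 is "mat 1"
  by (simp add: psl2_rel_def)

lift_definition times_psl2 :: "psl2 \<Rightarrow> psl2 \<Rightarrow> psl2" is "\<lambda>A B. A ** B"
  by (auto simp: psl2_rel_def det_mul matrix_mul_uminus)

lift_definition inverse_psl2 :: "psl2 \<Rightarrow> psl2" is matrix_inv
  by (auto simp: psl2_rel_def det_matrix_inv matrix_inv_uminus)

definition divide_psl2 :: "psl2 \<Rightarrow> psl2 \<Rightarrow> psl2" where
  "divide_psl2 g h = g * inverse h"

instance
proof
  fix a b c :: psl2
  show "a * b * c = a * (b * c)"
    by transfer (auto simp: psl2_rel_def det_mul matrix_mul_assoc)
  show "1 * a = a"
    by transfer (auto simp: psl2_rel_def)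
  show "a * 1 = a"
    by transfer (auto simp: psl2_rel_def)
qed

end

lemma psl2_inverse [simp]:
  fixes g :: psl2
  shows "inverse g * g = 1" "g * inverse g = 1"
  by (transfer, simp add: psl2_rel_def det_mul det_matrix_inv matrix_inv_det_1)+

text \<open>The element represented by the matrix with rows \<open>(a, b)\<close> and \<open>(c, d)\<close>; it is meaningful
  only if \<open>a * d - b * c = 1\<close>.\<close>

definition psl2_mat :: "real \<Rightarrow> real \<Rightarrow> real \<Rightarrow> real \<Rightarrow> psl2" where
  "psl2_mat a b c d = abs_psl2 (vector [vector [a, b], vector [c, d]])"

definition a_elem :: "real \<Rightarrow> psl2" where
  "a_elem L = psl2_mat (exp (L / 2)) 0 0 (exp (- L / 2))"

definition S_elem :: psl2 where
  "S_elem = psl2_mat 0 1 (-1) 0"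


section \<open>Fractional linear transformations of the Riemann sphere\<close>

text \<open>The Riemann sphere is the Alexandroff compactification of \<open>\<complex>\<close>, with \<open>None\<close> as the point
  at infinity.\<close>

type_synonym riemann_sphere = "complex option"

abbreviation sphere_top :: "riemann_sphere topology" where
  "sphere_top \<equiv> Alexandroff_compactification euclidean"

lemma frac_linear_uminus:
  fixes a b c d z :: complex
  shows "- c * z + - d = 0 \<longleftrightarrow> c * z + d = 0"
    and "(- a * z + - b) / (- c * z + - d) = (a * z + b) / (c * z + d)"
proof -
  have *: "- x * z + - y = - (x * z + y)" for x y
    by simp
  show "- c * z + - d = 0 \<longleftrightarrow> c * z + d = 0"
    unfolding * by (rule neg_equal_0_iff_equal)
  show "(- a * z + - b) / (- c * z + - d) = (a * z + b) / (c * z + d)"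
    unfolding * by (rule minus_divide_divide)
qed

lift_definition psl2_act :: "psl2 \<Rightarrow> riemann_sphere \<Rightarrow> riemann_sphere" is
  "\<lambda>(A :: real^2^2) w. case w of
      None \<Rightarrow> if A$2$1 = 0 then None else Some (of_real (A$1$1) / of_real (A$2$1))
    | Some z \<Rightarrow> if of_real (A$2$1) * z + of_real (A$2$2) = 0 then None
        else Some ((of_real (A$1$1) * z + of_real (A$1$2)) / (of_real (A$2$1) * z + of_real (A$2$2)))"
  unfolding psl2_rel_def
  by (elim conjE disjE; hypsubst)
    (simp_all only: vector_uminus_component of_real_minus frac_linear_uminus
      neg_equal_0_iff_equal minus_divide_divide)

text \<open>The same action read in \<open>\<complex>\<close>; the value at a pole is irrelevant.\<close>

lift_definition moebius :: "psl2 \<Rightarrow> complex \<Rightarrow> complex" is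
  "\<lambda>(A :: real^2^2) z.
     (of_real (A$1$1) * z + of_real (A$1$2)) / (of_real (A$2$1) * z + of_real (A$2$2))"
  unfolding psl2_rel_def
  by (elim conjE disjE; hypsubst)
    (simp_all only: vector_uminus_component of_real_minus frac_linear_uminus)


section \<open>Hyperbolic cylinders\<close>

definition upper_half_plane :: "complex set" where
  "upper_half_plane = {z. Im z > 0}"

definition hyp_dist :: "complex \<Rightarrow> complex \<Rightarrow> real" where
  "hyp_dist z w = arcosh (1 + (cmod (z - w))\<^sup>2 / (2 * Im z * Im w))"

text \<open>The quotient of the upper half plane by the cyclic group generated by \<open>g\<close>, as the set of
  orbits; its metric is the distance between orbits.\<close>

definition orbit :: "psl2 \<Rightarrow> complex \<Rightarrow> complex set" where
  "orbit g z = range (\<lambda>k :: int. moebius (g powi k) z)"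

definition cyclic_quotient :: "psl2 \<Rightarrow> complex set set" where
  "cyclic_quotient g = orbit g ` upper_half_plane"

definition quotient_dist :: "complex set \<Rightarrow> complex set \<Rightarrow> real" where
  "quotient_dist A B = Inf {hyp_dist z w |z w. z \<in> A \<and> w \<in> B}"

definition isometric_quotients :: "psl2 \<Rightarrow> psl2 \<Rightarrow> bool" where
  "isometric_quotients g h \<longleftrightarrow>
     (\<exists>F. bij_betw F (cyclic_quotient g) (cyclic_quotient h) \<and>
        (\<forall>A \<in> cyclic_quotient g. \<forall>B \<in> cyclic_quotient g.
           quotient_dist (F A) (F B) = quotient_dist A B))"


section \<open>Schottky data\<close>

text \<open>An open Euclidean disk of the Riemann sphere centered on \<open>\<real> \<union> {\<infinity>}\<close>: the elements of
  \<open>PSL\<^sub>2(\<real>)\<close> commute with complex conjugation, so a disk whose boundary circle is symmetric about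
  the real line is one that can be moved to a disk of \<open>\<complex>\<close> with real center.\<close>

definition real_disk :: "riemann_sphere set \<Rightarrow> bool" where
  "real_disk D \<longleftrightarrow>
     (\<exists>g (c :: real) r. r > 0 \<and> psl2_act g ` D = Some ` ball (complex_of_real c) r)"

definition schottky_data ::
    "real \<Rightarrow> riemann_sphere set \<Rightarrow> riemann_sphere set \<Rightarrow> psl2 \<Rightarrow> bool" where
  "schottky_data l D1 Dm1 S1 \<longleftrightarrow>
     real_disk D1 \<and> real_disk Dm1 \<and>
     (sphere_top closure_of D1) \<inter> (sphere_top closure_of Dm1) = {} \<and>
     psl2_act S1 ` (UNIV - sphere_top closure_of D1) = sphere_top interior_of Dm1 \<and>
     isometric_quotients S1 (a_elem l)"


section \<open>The operators \<open>\<tau>\<^sub>s\<close> and the Bergman spaces\<close>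

text \<open>\<open>\<tau>\<^sub>s(g)f(z) = ((g\<^sup>-\<^sup>1)'(z))\<^sup>s f(g\<^sup>-\<^sup>1.z)\<close> as a function on \<open>D\<close>, extended by zero.
  With \<open>g\<^sup>-\<^sup>1\<close> represented by \<open>(a, b; c, d)\<close> the derivative is \<open>(c z + d)\<^sup>-\<^sup>2\<close>, and \<open>c z + d\<close> has no purely
  imaginary value on a disk with real center that does not contain the pole. Hence the principal
  power is the holomorphic branch equal to \<open>\<bar>c x + d\<bar>\<^sup>-\<^sup>2\<^sup>s\<close> at the real points; see
  \<open>deriv_moebius_powr_branch\<close> below.\<close>

definition tau ::
    "complex \<Rightarrow> psl2 \<Rightarrow> complex set \<Rightarrow> (complex \<Rightarrow> complex) \<Rightarrow> complex \<Rightarrow> complex" where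
  "tau s g D f = (\<lambda>z. if z \<in> D
     then (deriv (moebius (inverse g)) z) powr s * f (moebius (inverse g) z) else 0)"

lemma moebius_psl2_mat:
  assumes "a * d - b * c = 1"
  shows "moebius (psl2_mat a b c d) z =
    (of_real a * z + of_real b) / (of_real c * z + of_real d)"
  using assms
  by (simp add: psl2_mat_def moebius.abs_eq psl2_rel_def det_2)

lemma deriv_moebius_psl2_mat:
  assumes det: "a * d - b * c = 1" and pole: "of_real c * z + of_real d \<noteq> (0 :: complex)"
  shows "deriv (moebius (psl2_mat a b c d)) z = 1 / (of_real c * z + of_real d)\<^sup>2"
proof -
  have eq: "moebius (psl2_mat a b c d) = (\<lambda>z. (of_real a * z + of_real b) / (of_real c * z + of_real d))"
    using det by (simp add: fun_eq_iff moebius_psl2_mat)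
  have cdet: "of_real a * of_real d - of_real b * of_real c = (1 :: complex)"
    using det by (metis of_real_1 of_real_diff of_real_mult)
  have num: "of_real a * (of_real c * z + of_real d) - (of_real a * z + of_real b) * of_real c
      = (1 :: complex)"
    using cdet by (simp add: algebra_simps)
  have "((\<lambda>z. (of_real a * z + of_real b) / (of_real c * z + of_real d)) has_field_derivative
      (of_real a * (of_real c * z + of_real d) - (of_real a * z + of_real b) * of_real c) /
        ((of_real c * z + of_real d) * (of_real c * z + of_real d))) (at z)"
    using pole by (auto intro!: derivative_eq_intros)
  then show ?thesis
    unfolding eq num by (simp add: DERIV_imp_deriv power2_eq_square)
qed

lemma deriv_moebius_powr_branch:
  fixes a b c d x0 r :: real and s :: complex
  assumes det: "a * d - b * c = 1"
    and pole: "\<And>z. z \<in> ball (complex_of_real x0) r \<Longrightarrow> of_real c * z + of_real d \<noteq> (0 :: complex)"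
  shows "(\<lambda>z. (deriv (moebius (psl2_mat a b c d)) z) powr s)
           holomorphic_on ball (complex_of_real x0) r"
    and "\<And>x :: real. of_real x \<in> ball (complex_of_real x0) r \<Longrightarrow>
           (deriv (moebius (psl2_mat a b c d)) (of_real x)) powr s =
             complex_of_real \<bar>c * x + d\<bar> powr (- 2 * s)"
proof -
  have Re0: "c * Re z + d \<noteq> 0" if "z \<in> ball (complex_of_real x0) r" for z
  proof
    assume "c * Re z + d = 0"
    moreover have "complex_of_real (Re z) \<in> ball (complex_of_real x0) r"
    proof -
      have "cmod (complex_of_real x0 - of_real (Re z)) \<le> cmod (complex_of_real x0 - z)"
        using abs_Re_le_cmod[of "complex_of_real x0 - z"]
        by (metis Re_complex_of_real minus_complex.sel(1) norm_of_real of_real_diff)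
      then show ?thesis
        using that by (simp add: dist_norm)
    qed
    ultimately show False
      using pole[of "of_real (Re z)"] by (metis of_real_0 of_real_add of_real_mult)
  qed
  have slit: "1 / (of_real c * z + of_real d)\<^sup>2 \<notin> \<real>\<^sub>\<le>\<^sub>0" if z: "z \<in> ball (complex_of_real x0) r" for z
  proof
    define w where "w = of_real c * z + of_real d"
    have Re: "Re w \<noteq> 0"
      using Re0[OF z] by (simp add: w_def)
    assume "1 / (of_real c * z + of_real d)\<^sup>2 \<in> \<real>\<^sub>\<le>\<^sub>0"
    then have "inverse (w\<^sup>2) \<in> \<real>\<^sub>\<le>\<^sub>0"
      by (simp add: w_def inverse_eq_divide)
    then have "w\<^sup>2 \<in> \<real>\<^sub>\<le>\<^sub>0"
      by simp
    then obtain t where t: "w\<^sup>2 = of_real t" "t \<le> 0"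
      by (auto elim!: nonpos_Reals_cases)
    then have "Re (w\<^sup>2) = t" "Im (w\<^sup>2) = 0"
      by simp_all
    then have "(Re w)\<^sup>2 - (Im w)\<^sup>2 = t" "Im w = 0"
      using Re by (auto simp: power2_eq_square)
    then have "(Re w)\<^sup>2 \<le> 0"
      using t(2) by simp
    then show False
      using Re by simp
  qed
  have eq: "deriv (moebius (psl2_mat a b c d)) z = 1 / (of_real c * z + of_real d)\<^sup>2"
    if "z \<in> ball (complex_of_real x0) r" for z
    using deriv_moebius_psl2_mat[OF det pole[OF that]] .
  have "(\<lambda>z. (1 / (of_real c * z + of_real d)\<^sup>2) powr s) holomorphic_on ball (complex_of_real x0) r"
    using slit pole by (auto intro!: holomorphic_intros)
  then show "(\<lambda>z. (deriv (moebius (psl2_mat a b c d)) z) powr s)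
           holomorphic_on ball (complex_of_real x0) r"
    by (rule holomorphic_transform) (simp add: eq)
  fix x :: real
  assume x: "of_real x \<in> ball (complex_of_real x0) r"
  define y where "y = \<bar>c * x + d\<bar>"
  have y: "y > 0"
    using Re0[OF x] by (simp add: y_def)
  have "deriv (moebius (psl2_mat a b c d)) (of_real x) = of_real (1 / y\<^sup>2)"
    by (simp add: eq[OF x] y_def)
  also have "\<dots> powr s = of_real y powr (- 2 * s)"
  proof -
    have "Ln (complex_of_real (1 / y\<^sup>2)) = of_real (- 2 * ln y)"
      using y by (subst Ln_of_real) (simp_all add: ln_div ln_realpow)
    moreover have "Ln (complex_of_real y) = of_real (ln y)"
      using y by (simp add: Ln_of_real)
    ultimately show ?thesis
      using y by (simp add: powr_def mult_ac)
  qed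
  finally show "(deriv (moebius (psl2_mat a b c d)) (of_real x)) powr s =
             complex_of_real \<bar>c * x + d\<bar> powr (- 2 * s)"
    by (simp add: y_def)
qed

text \<open>A function on \<open>D\<close> is represented by its extension by zero, so that equality of functions is
  equality on \<open>D\<close>.\<close>

definition bergman :: "complex set \<Rightarrow> (complex \<Rightarrow> complex) set" where
  "bergman D = {f. f holomorphic_on D \<and> set_integrable lborel D (\<lambda>z. (cmod (f z))\<^sup>2) \<and>
     (\<forall>z. z \<notin> D \<longrightarrow> f z = 0)}"

text \<open>For a disk \<open>D\<close> of the Riemann sphere, \<open>H\<^sup>2(D)\<close> is identified through \<open>\<tau>\<^sub>s(q)\<close> with the
  Bergman space of the bounded disk \<open>q.D\<close>. If \<open>D\<close> is bounded, then \<open>q = 1\<close> is allowed and gives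
  \<open>H\<^sup>2(D)\<close> itself.\<close>

definition bounded_chart :: "psl2 \<Rightarrow> riemann_sphere set \<Rightarrow> bool" where
  "bounded_chart q D \<longleftrightarrow> (\<exists>c r. r > 0 \<and> psl2_act q ` D = Some ` ball c r)"

definition chart_image :: "psl2 \<Rightarrow> riemann_sphere set \<Rightarrow> complex set" where
  "chart_image q D = {z. Some z \<in> psl2_act q ` D}"

definition H2 :: "psl2 \<Rightarrow> riemann_sphere set \<Rightarrow> (complex \<Rightarrow> complex) set" where
  "H2 q D = bergman (chart_image q D)"

text \<open>\<open>\<tau>\<^sub>s(g)\<close> from functions on a disk identified through \<open>q'\<close> to functions on \<open>D\<close> identified
  through \<open>q\<close>, that is, \<open>\<tau>\<^sub>s(q) \<tau>\<^sub>s(g) \<tau>\<^sub>s(q')\<^sup>-\<^sup>1\<close>.\<close>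

definition tau_chart ::
    "complex \<Rightarrow> psl2 \<Rightarrow> psl2 \<Rightarrow> riemann_sphere set \<Rightarrow> psl2 \<Rightarrow>
      (complex \<Rightarrow> complex) \<Rightarrow> complex \<Rightarrow> complex" where
  "tau_chart s q q' D g = tau s (q * g * inverse q') (chart_image q D)"


section \<open>The transfer operator\<close>

type_synonym function_pair = "(complex \<Rightarrow> complex) \<times> (complex \<Rightarrow> complex)"

definition pair_scale :: "complex \<Rightarrow> function_pair \<Rightarrow> function_pair" where
  "pair_scale k F = ((\<lambda>z. k * fst F z), (\<lambda>z. k * snd F z))"

interpretation pairs: vector_space pair_scale
  by unfold_locales (auto simp: pair_scale_def algebra_simps fun_eq_iff prod_eq_iff)

definition H_space ::
    "psl2 \<Rightarrow> riemann_sphere set \<Rightarrow> psl2 \<Rightarrow> riemann_sphere set \<Rightarrow> function_pair set" where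
  "H_space q1 D1 qm1 Dm1 = H2 q1 D1 \<times> H2 qm1 Dm1"

definition transfer_op ::
    "complex \<Rightarrow> psl2 \<Rightarrow> psl2 \<Rightarrow> riemann_sphere set \<Rightarrow> psl2 \<Rightarrow> riemann_sphere set \<Rightarrow>
      function_pair \<Rightarrow> function_pair" where
  "transfer_op s S1 q1 D1 qm1 Dm1 =
     (\<lambda>(f1, fm1). (tau_chart s q1 q1 D1 S1 f1, tau_chart s qm1 qm1 Dm1 (inverse S1) fm1))"

definition eigenspace ::
    "function_pair set \<Rightarrow> (function_pair \<Rightarrow> function_pair) \<Rightarrow> complex \<Rightarrow> function_pair set" where
  "eigenspace V T \<mu> = {F \<in> V. T F = pair_scale \<mu> F}"

definition is_eigenvalue ::
    "function_pair set \<Rightarrow> (function_pair \<Rightarrow> function_pair) \<Rightarrow> complex \<Rightarrow> bool" where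
  "is_eigenvalue V T \<mu> \<longleftrightarrow> (\<exists>F \<in> eigenspace V T \<mu>. F \<noteq> 0)"

definition geometric_multiplicity ::
    "function_pair set \<Rightarrow> (function_pair \<Rightarrow> function_pair) \<Rightarrow> complex \<Rightarrow> nat" where
  "geometric_multiplicity V T \<mu> = pairs.dim (eigenspace V T \<mu>)"

text \<open>The set \<open>- n + (2 \<pi> i / l) \<int>\<close>.\<close>

definition resonance_line :: "real \<Rightarrow> nat \<Rightarrow> complex set" where
  "resonance_line l n =
     range (\<lambda>k :: int. - of_nat n + 2 * of_real pi * \<i> / of_real l * of_int k)"

end

theory Submission
  imports Defs
begin

text \<open>The transfer operator is diagonal, so its fixed vectors are pairs of fixed vectors of
\<open>\<tau>\<^sub>s(S\<^sub>1)\<close> on \<open>\<D>\<^sub>1\<close> and of \<open>\<tau>\<^sub>s(S\<^sub>1\<^sup>-\<^sup>1)\<close> on \<open>\<D>\<^sub>-\<^sub>1\<close>.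
Conjugation by \<open>p\<close> moves the fixed points of \<open>S\<^sub>1\<close> to \<open>0\<close> and \<open>\<infinity>\<close>, and \<open>p\<^sup>-\<^sup>1.\<D>\<^sub>1\<close> becomes a bounded
neighbourhood \<open>U\<close> of \<open>0\<close> with \<open>e\<^sup>-\<^sup>l U \<subseteq> U\<close>. By the cocycle rule for the weights
(\<open>weight_cocycle\<close>), a fixed vector becomes a holomorphic function \<open>P\<close> on \<open>U\<close> with
\<open>P(e\<^sup>-\<^sup>l w) = e\<^sup>l\<^sup>s P(w)\<close>. Comparing Taylor coefficients at \<open>0\<close> shows that \<open>P\<close> is a multiple
of one monomial \<open>w\<^sup>n\<close> and that \<open>e\<^sup>l\<^sup>s = e\<^sup>-\<^sup>l\<^sup>n\<close>, that is, \<open>s \<in> - n + (2 \<pi> i / l) \<int>\<close>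
(\<open>scaling_eigenfunction_monomial\<close>). The real part of \<open>s\<close> determines \<open>n\<close>, so each of
the two components contributes exactly one line (\<open>eigenfunctions_eq\<close>). The second component is the
first one for \<open>S\<^sub>1\<^sup>-\<^sup>1\<close> and \<open>p S\<close>, since \<open>S a\<^sub>l S\<^sup>-\<^sup>1 = a\<^sub>-\<^sub>l\<close>.

It remains to produce \<open>p\<close>. A Schottky data forces \<open>S\<^sub>1\<close> to map the closure of \<open>\<D>\<^sub>-\<^sub>1\<close> into
\<open>\<D>\<^sub>-\<^sub>1\<close> and \<open>S\<^sub>1\<^sup>-\<^sup>1\<close> to map the closure of \<open>\<D>\<^sub>1\<close> into \<open>\<D>\<^sub>1\<close>; a fixed point theorem on the
real diameters gives two real fixed points, hence \<open>S\<^sub>1 = p a\<^sub>L p\<^sup>-\<^sup>1\<close> with some \<open>L > 0\<close>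
(\<open>schottky_data_hyperbolic\<close>). That \<open>L = l\<close> must be read off from the metric of the quotient
alone: two points of the cylinder that have two different midpoints lie on opposite sides, and
the least distance between such points is \<open>L / 2\<close>, attained on the central geodesic
(\<open>cylinder_length_unique\<close>).\<close>

section \<open>Fractional linear transformations in coordinates\<close>

lemma psl2_rel_refl_vector:
  "a * d - b * c = 1 \<Longrightarrow> psl2_rel (vector [vector [a, b], vector [c, d]]) (vector [vector [a, b], vector [c, d]])"
  by (simp add: psl2_rel_def det_2)

lemma psl2_cases:
  obtains a b c d where "g = psl2_mat a b c d" "a * d - b * c = 1"
proof -
  define A where "A = rep_psl2 g"
  have rel: "psl2_rel A A" and g: "g = abs_psl2 A"
    unfolding A_def using Quotient3_psl2 by (simp_all add: Quotient3_rep_reflp Quotient3_abs_rep)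
  have "A = vector [vector [A$1$1, A$1$2], vector [A$2$1, A$2$2]]"
    by (simp add: vec_eq_iff forall_2)
  then have "g = psl2_mat (A$1$1) (A$1$2) (A$2$1) (A$2$2)"
    using g by (simp add: psl2_mat_def)
  moreover have "A$1$1 * A$2$2 - A$1$2 * A$2$1 = 1"
    using rel by (simp add: psl2_rel_def det_2)
  ultimately show ?thesis by (rule that)
qed

lemma psl2_mat_uminus:
  assumes "a * d - b * c = 1"
  shows "psl2_mat (- a) (- b) (- c) (- d) = psl2_mat a b c d"
proof -
  have "psl2_rel (vector [vector [-a, -b], vector [-c, -d]]) (vector [vector [a, b], vector [c, d]])"
    using assms by (auto simp: psl2_rel_def det_2 vec_eq_iff forall_2)
  then show ?thesis
    unfolding psl2_mat_def by (rule Quotient3_rel_abs[OF Quotient3_psl2])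
qed

lemma psl2_mat_mult:
  assumes "a * d - b * c = 1" "a' * d' - b' * c' = 1"
  shows "psl2_mat a b c d * psl2_mat a' b' c' d' =
    psl2_mat (a * a' + b * c') (a * b' + b * d') (c * a' + d * c') (c * b' + d * d')"
proof -
  have "(vector [vector [a, b], vector [c, d]] :: real^2^2) ** vector [vector [a', b'], vector [c', d']] =
     (vector [vector [a * a' + b * c', a * b' + b * d'], vector [c * a' + d * c', c * b' + d * d']] :: real^2^2)"
    by (simp add: vec_eq_iff forall_2 matrix_matrix_mult_def sum_2 UNIV_2)
  then show ?thesis
    unfolding psl2_mat_def using assms by (simp add: times_psl2.abs_eq psl2_rel_refl_vector)
qed

lemma psl2_mat_one: "psl2_mat 1 0 0 1 = 1"
proof -
  have "vector [vector [1, 0], vector [0, 1]] = (mat 1 :: real^2^2)"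
    by (simp add: vec_eq_iff forall_2 mat_def)
  then show ?thesis
    by (simp add: psl2_mat_def one_psl2_def)
qed

lemma psl2_inverse_unique:
  fixes g h :: psl2
  assumes "g * h = 1"
  shows "inverse g = h"
  by (metis assms mult.assoc mult.left_neutral mult.right_neutral psl2_inverse(1))

lemma psl2_mat_inverse:
  assumes "a * d - b * c = 1"
  shows "inverse (psl2_mat a b c d) = psl2_mat d (- b) (- c) a"
  by (rule psl2_inverse_unique)
    (use assms in \<open>simp add: psl2_mat_mult psl2_mat_one[symmetric] algebra_simps\<close>)

lemma psl2_inverse_mult: "inverse (g * h) = inverse h * inverse (g :: psl2)"
proof (rule psl2_inverse_unique)
  have "g * h * (inverse h * inverse g) = g * (h * inverse h) * inverse g"
    by (simp only: mult.assoc)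
  then show "g * h * (inverse h * inverse g) = 1" by simp
qed

lemma psl2_inverse_inverse [simp]: "inverse (inverse g) = (g :: psl2)"
  by (rule psl2_inverse_unique) simp

lemma psl2_inverse_one [simp]: "inverse 1 = (1 :: psl2)"
  by (rule psl2_inverse_unique) simp

lemma psl2_act_psl2_mat:
  assumes "a * d - b * c = 1"
  shows "psl2_act (psl2_mat a b c d) w = (case w of
      None \<Rightarrow> if c = 0 then None else Some (of_real a / of_real c)
    | Some z \<Rightarrow> if of_real c * z + of_real d = 0 then None
        else Some ((of_real a * z + of_real b) / (of_real c * z + of_real d)))"
  unfolding psl2_mat_def using assms
  by (simp add: psl2_act.abs_eq psl2_rel_refl_vector split: option.split)

lemma det_complex:
  assumes "a * d - b * c = (1 :: real)"
  shows "of_real a * of_real d - of_real b * of_real c = (1 :: complex)"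
  using assms by (metis of_real_1 of_real_diff of_real_mult)

text \<open>Besides the generic point, the cases to check are \<open>\<infinity>\<close>, the pole of \<open>h\<close> and the pole of \<open>g h\<close>; at a
pole of \<open>h\<close> the numerator of \<open>h\<close> cannot vanish as well, because the determinant is \<open>1\<close>.\<close>

lemma psl2_act_mult: "psl2_act (g * h) w = psl2_act g (psl2_act h w)"
proof -
  obtain a b c d where g: "g = psl2_mat a b c d" and dg: "a * d - b * c = 1" by (rule psl2_cases)
  obtain a' b' c' d' where h: "h = psl2_mat a' b' c' d'" and dh: "a' * d' - b' * c' = 1" by (rule psl2_cases)
  have det: "(a * a' + b * c') * (c * b' + d * d') - (a * b' + b * d') * (c * a' + d * c') = 1"
  proof -
    have "(a * a' + b * c') * (c * b' + d * d') - (a * b' + b * d') * (c * a' + d * c')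
      = (a * d - b * c) * (a' * d' - b' * c')" by (simp add: algebra_simps)
    then show ?thesis using dg dh by simp
  qed
  have gh: "psl2_act (g * h) v = (case v of
      None \<Rightarrow> if c * a' + d * c' = 0 then None else Some (of_real (a * a' + b * c') / of_real (c * a' + d * c'))
    | Some z \<Rightarrow> if of_real (c * a' + d * c') * z + of_real (c * b' + d * d') = 0 then None
        else Some ((of_real (a * a' + b * c') * z + of_real (a * b' + b * d')) /
          (of_real (c * a' + d * c') * z + of_real (c * b' + d * d'))))" for v
    unfolding g h psl2_mat_mult[OF dg dh] by (rule psl2_act_psl2_mat[OF det])
  note act = gh psl2_act_psl2_mat[OF dg, folded g] psl2_act_psl2_mat[OF dh, folded h]
  note dgc = det_complex[OF dg] and dhc = det_complex[OF dh]
  show ?thesis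
  proof (cases w)
    case None
    show ?thesis
    proof (cases "c' = 0")
      case True
      then have "a' \<noteq> 0" using dh by auto
      then show ?thesis using None True by (simp add: act)
    next
      case False
      then have "complex_of_real c' \<noteq> 0" by simp
      then have eqs: "complex_of_real c * (of_real a' / of_real c') + of_real d = of_real (c * a' + d * c') / of_real c'"
        "complex_of_real a * (of_real a' / of_real c') + of_real b = of_real (a * a' + b * c') / of_real c'"
        by (simp_all add: field_simps)
      show ?thesis unfolding act None option.case if_not_P[OF False] eqs
        using \<open>complex_of_real c' \<noteq> 0\<close> by (simp del: of_real_add of_real_mult)
    qed
  next
    case (Some z)
    define N where "N = of_real a' * z + of_real b'"
    define M where "M = of_real c' * z + of_real d'"
    have n: "of_real (a * a' + b * c') * z + of_real (a * b' + b * d') = of_real a * N + of_real b * M"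
      "of_real (c * a' + d * c') * z + of_real (c * b' + d * d') = of_real c * N + of_real d * M"
      by (simp_all add: N_def M_def algebra_simps)
    have nz: "N \<noteq> 0" if "M = 0"
    proof
      assume "N = 0"
      have "of_real a' * M - of_real c' * N = of_real a' * of_real d' - of_real b' * of_real c'"
        by (simp add: N_def M_def algebra_simps)
      then show False using dhc that \<open>N = 0\<close> by simp
    qed
    have acth: "psl2_act h w = (if M = 0 then None else Some (N / M))"
      unfolding act Some option.case N_def M_def by simp
    show ?thesis
    proof (cases "M = 0")
      case True
      then show ?thesis using nz[OF True]
        unfolding acth unfolding act Some option.case n by simp
    next
      case False
      then have "of_real c * (N / M) + of_real d = (of_real c * N + of_real d * M) / M"
        "of_real a * (N / M) + of_real b = (of_real a * N + of_real b * M) / M"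
        by (simp_all add: field_simps)
      then show ?thesis using False
        unfolding acth unfolding act Some option.case n if_not_P[OF False] by simp
    qed
  qed
qed

lemma psl2_act_one [simp]: "psl2_act 1 w = w"
  by (subst psl2_mat_one[symmetric], subst psl2_act_psl2_mat) (auto split: option.split)

lemma psl2_act_inverse [simp]:
  "psl2_act (inverse g) (psl2_act g w) = w" "psl2_act g (psl2_act (inverse g) w) = w"
  by (simp_all flip: psl2_act_mult)

lemma inj_psl2_act: "inj (psl2_act g)"
  by (metis injI psl2_act_inverse(1))

lemma psl2_act_image_mult: "psl2_act (g * h) ` X = psl2_act g ` psl2_act h ` X"
  by (simp add: image_image psl2_act_mult)

text \<open>The matrix entries are real. This symmetry is what keeps the center of a bounded chart of a real
disk on the real line.\<close>

lemma psl2_act_cnj: "psl2_act g (map_option cnj w) = map_option cnj (psl2_act g w)"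
proof -
  obtain a b c d where g: "g = psl2_mat a b c d" and dg: "a * d - b * c = 1" by (rule psl2_cases)
  have "of_real c * cnj z + of_real d = cnj (of_real c * z + of_real d)" for z by simp
  then have "of_real c * cnj z + of_real d = 0 \<longleftrightarrow> of_real c * z + of_real d = 0" for z
    by (metis complex_cnj_zero_iff)
  then show ?thesis
    by (auto simp: g psl2_act_psl2_mat[OF dg] split: option.split)
qed

lemma psl2_act_Some_moebius:
  assumes "psl2_act g (Some z) \<noteq> None"
  shows "psl2_act g (Some z) = Some (moebius g z)"
proof -
  obtain a b c d where g: "g = psl2_mat a b c d" and dg: "a * d - b * c = 1" by (rule psl2_cases)
  show ?thesis using assms
    by (auto simp: g psl2_act_psl2_mat[OF dg] moebius_psl2_mat[OF dg] split: if_splits)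
qed

lemma a_elem_act: "psl2_act (a_elem L) (Some z) = Some (of_real (exp L) * z)" "psl2_act (a_elem L) None = None"
proof -
  have det: "exp (L / 2) * exp (- L / 2) - 0 * 0 = (1::real)" by (simp flip: exp_add)
  have "complex_of_real (exp (L/2)) / of_real (exp (- L / 2)) = of_real (exp (L/2) / exp (- L/2))" by simp
  also have "exp (L/2) / exp (- L/2) = exp L" by (simp flip: exp_diff)
  finally have quot: "complex_of_real (exp (L/2)) / of_real (exp (- L / 2)) = of_real (exp L)" .
  have "(of_real (exp (L/2)) * z + of_real 0) / (of_real 0 * z + of_real (exp (- L / 2))) =
      complex_of_real (exp (L/2)) / of_real (exp (- L / 2)) * z"
    by simp
  then show "psl2_act (a_elem L) (Some z) = Some (of_real (exp L) * z)"
    unfolding a_elem_def psl2_act_psl2_mat[OF det] quot by simp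
  show "psl2_act (a_elem L) None = None"
    unfolding a_elem_def by (subst psl2_act_psl2_mat[OF det]) simp
qed

lemma a_elem_add: "a_elem L * a_elem M = a_elem (L + M)"
  unfolding a_elem_def by (subst psl2_mat_mult) (simp_all add: add_divide_distrib diff_divide_distrib flip: exp_add)

lemma a_elem_inverse: "inverse (a_elem L) = a_elem (- L)"
  unfolding a_elem_def by (subst psl2_mat_inverse) (simp_all flip: exp_add)

text \<open>Conjugation by \<open>S\<close> exchanges the two fixed points \<open>0\<close> and \<open>\<infinity>\<close>; it turns every fact about the
repelling fixed point of an element into one about the attracting fixed point.\<close>

lemma S_elem_conj: "S_elem * a_elem L * inverse S_elem = a_elem (- L)"
  unfolding a_elem_def S_elem_def
  by (simp add: psl2_mat_inverse psl2_mat_mult flip: exp_add)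

lemma S_elem_act: "psl2_act S_elem None = Some 0" "psl2_act S_elem (Some 0) = None"
  unfolding S_elem_def by (simp_all add: psl2_act_psl2_mat)

section \<open>The action on the sphere is by homeomorphisms\<close>

text \<open>A description of the topology by filters: openness at \<open>\<infinity>\<close> means containing all points of large
modulus. Continuity of a fractional linear map then splits into four elementary limits, according
to whether the point and its image are finite.\<close>

lemma openin_sphere_iff:
  "openin sphere_top S \<longleftrightarrow>
     open {z. Some z \<in> S} \<and> (None \<in> S \<longrightarrow> eventually (\<lambda>z. Some z \<in> S) at_infinity)"
  (is "?L \<longleftrightarrow> ?R")
proof
  assume ?L
  then consider U where "open U" "S = Some ` U"
    | C where "compact C" "S = insert None (Some ` (UNIV - C))"
    by (auto simp: openin_Alexandroff_compactification)
  then show ?R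
  proof cases
    case 1
    then have "{z. Some z \<in> S} = U" by auto
    with 1 show ?thesis by auto
  next
    case 2
    then have eq: "{z. Some z \<in> S} = - C" by auto
    obtain b where "\<forall>z\<in>C. norm z \<le> b"
      using compact_imp_bounded[OF 2(1)] by (auto simp: bounded_iff)
    then have "\<forall>z. norm z \<ge> b + 1 \<longrightarrow> Some z \<in> S"
      using 2(2) by force
    then have "eventually (\<lambda>z. Some z \<in> S) at_infinity"
      by (auto simp: eventually_at_infinity)
    then show ?thesis
      unfolding eq using 2(1) by (simp add: open_Compl compact_imp_closed)
  qed
next
  assume R: ?R
  show ?L
  proof (cases "None \<in> S")
    case False
    then have "S = Some ` {z. Some z \<in> S}"
      by (auto simp: image_iff) (metis not_None_eq)
    then show ?thesis
      unfolding openin_Alexandroff_compactification using R by (intro disjI1 exI[of _ "{z. Some z \<in> S}"]) simp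
  next
    case True
    define C where "C = - {z. Some z \<in> S}"
    have "bounded C"
      using R True by (force simp: eventually_at_infinity bounded_iff C_def not_le intro: less_imp_le)
    then have "compact C"
      using R by (simp add: compact_eq_bounded_closed C_def closed_Compl)
    moreover have "S = insert None (Some ` (UNIV - C))"
      using True by (auto simp: C_def image_iff) (metis not_None_eq)
    ultimately show ?thesis
      unfolding openin_Alexandroff_compactification
      by (intro disjI2 exI[of _ C]) (simp add: compact_imp_closed)
  qed
qed

lemma psl2_act_tendsto:
  assumes S: "openin sphere_top S" and x: "psl2_act g x \<in> S"
  shows "eventually (\<lambda>w. psl2_act g (Some w) \<in> S) (case x of None \<Rightarrow> at_infinity | Some z \<Rightarrow> at z)"
proof -
  obtain a b c d where g: "g = psl2_mat a b c d" and det: "a * d - b * c = 1" by (rule psl2_cases)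
  note detc = det_complex[OF det]
  note act = psl2_act_psl2_mat[OF det, folded g]
  define N where "N = (\<lambda>w. complex_of_real a * w + of_real b)"
  define M where "M = (\<lambda>w. complex_of_real c * w + of_real d)"
  have actM: "psl2_act g (Some w) = Some (N w / M w)" if "M w \<noteq> 0" for w
    using that by (simp add: act N_def M_def)
  have open_S: "open {z. Some z \<in> S}" and inf_S: "None \<in> S \<Longrightarrow> eventually (\<lambda>z. Some z \<in> S) at_infinity"
    using S by (auto simp: openin_sphere_iff)
  \<comment> \<open>It suffices that the fractional linear map has no pole near the point and has the right limit there.\<close>
  have fin: "eventually (\<lambda>w. psl2_act g (Some w) \<in> S) F"
    if "eventually (\<lambda>w. M w \<noteq> 0) F" "((\<lambda>w. N w / M w) \<longlongrightarrow> l) F" "Some l \<in> S" for F l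
    using that(1) topological_tendstoD[OF that(2) open_S, of] that(3)
    by (auto simp: actM elim: eventually_elim2)
  have inf: "eventually (\<lambda>w. psl2_act g (Some w) \<in> S) F"
    if "eventually (\<lambda>w. M w \<noteq> 0) F" "filterlim (\<lambda>w. N w / M w) at_infinity F" "None \<in> S" for F
    using that(1) eventually_compose_filterlim[OF inf_S[OF that(3)] that(2)]
    by eventually_elim (simp add: actM)
  have lim_N: "(N \<longlongrightarrow> N z) (at z)" and lim_M: "(M \<longlongrightarrow> M z) (at z)" for z
    unfolding N_def M_def by (auto intro!: tendsto_intros)
  show ?thesis
  proof (cases x)
    case (Some z)
    show ?thesis
    proof (cases "M z = 0")
      case False
      have "eventually (\<lambda>w. M w \<noteq> 0) (at z)"
        using tendsto_imp_eventually_ne[OF lim_M False] .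
      moreover have "((\<lambda>w. N w / M w) \<longlongrightarrow> N z / M z) (at z)"
        using lim_N lim_M False by (intro tendsto_divide)
      moreover have "Some (N z / M z) \<in> S"
        using x False by (simp add: Some actM)
      ultimately show ?thesis using fin Some by simp
    next
      case True
      then have "c \<noteq> 0"
        using det by (auto simp: M_def)
      have "M w \<noteq> 0" if "w \<noteq> z" for w
      proof
        assume "M w = 0"
        moreover have "of_real c * (w - z) = M w - M z"
          by (simp add: M_def algebra_simps)
        ultimately have "of_real c * (w - z) = 0"
          using True by simp
        then show False using \<open>c \<noteq> 0\<close> that by simp
      qed
      then have ne: "eventually (\<lambda>w. M w \<noteq> 0) (at z)"
        by (auto simp: eventually_at_filter)
      have "of_real c * N z - of_real a * M z = - 1"
        using detc by (simp add: N_def M_def algebra_simps)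
      then have "N z \<noteq> 0" using True by auto
      moreover have "filterlim M (at 0) (at z)"
        using lim_M[of z] True ne by (simp add: filterlim_at)
      ultimately have "filterlim (\<lambda>w. N w / M w) at_infinity (at z)"
        using lim_N by (intro filterlim_divide_at_infinity)
      moreover have "None \<in> S"
        using x True by (simp add: Some act M_def)
      ultimately show ?thesis using inf[OF ne] Some by simp
    qed
  next
    case None
    show ?thesis
    proof (cases "c = 0")
      case True
      then have ad: "a \<noteq> 0" "d \<noteq> 0" using det by auto
      have "filterlim (\<lambda>w. complex_of_real (a / d) * w + of_real (b / d)) at_infinity at_infinity"
        using ad by (intro tendsto_add_filterlim_at_infinity'[OF _ tendsto_const] tendsto_mult_filterlim_at_infinity[OF tendsto_const]
          filterlim_ident) simp_all
      then have "filterlim (\<lambda>w. N w / M w) at_infinity at_infinity"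
        using True by (simp add: N_def M_def add_divide_distrib)
      then show ?thesis
        using inf[of at_infinity] x None True ad by (simp add: act M_def)
    next
      case False
      have M_inf: "filterlim M at_infinity at_infinity"
        unfolding M_def using False
        by (intro tendsto_add_filterlim_at_infinity'[OF _ tendsto_const] tendsto_mult_filterlim_at_infinity[OF tendsto_const]
          filterlim_ident) simp_all
      then have ne: "eventually (\<lambda>w. M w \<noteq> 0) at_infinity"
        by (rule filterlim_at_infinity_imp_eventually_ne)
      have "((\<lambda>w. of_real (a / c) - of_real (1 / c) / M w) \<longlongrightarrow> of_real (a / c) - 0) at_infinity"
        by (intro tendsto_diff tendsto_const tendsto_divide_0[OF tendsto_const M_inf])
      moreover have "eventually (\<lambda>w. of_real (a / c) - of_real (1 / c) / M w = N w / M w) at_infinity"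
        using ne
      proof eventually_elim
        case (elim w)
        have "of_real a * M w - 1 = of_real c * N w"
          using detc by (simp add: N_def M_def algebra_simps)
        then show ?case using elim False by (simp add: field_simps)
      qed
      ultimately have "((\<lambda>w. N w / M w) \<longlongrightarrow> of_real (a / c)) at_infinity"
        by (simp add: tendsto_cong)
      moreover have "Some (of_real (a / c)) \<in> S"
        using x None False by (simp add: act)
      ultimately show ?thesis using fin[OF ne] None by simp
    qed
  qed
qed

lemma openin_psl2_act_vimage:
  assumes "openin sphere_top S"
  shows "openin sphere_top (psl2_act g -` S)"
  unfolding openin_sphere_iff
proof (intro conjI impI)
  show "open {z. Some z \<in> psl2_act g -` S}"
    unfolding open_subopen[of "{z. _ z}"]
  proof
    fix z assume z: "z \<in> {z. Some z \<in> psl2_act g -` S}"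
    then have "eventually (\<lambda>w. psl2_act g (Some w) \<in> S) (nhds z)"
      using psl2_act_tendsto[OF assms, of g "Some z"] by (auto simp: eventually_at_filter elim!: eventually_mono)
    then show "\<exists>T. open T \<and> z \<in> T \<and> T \<subseteq> {z. Some z \<in> psl2_act g -` S}"
      by (auto simp: eventually_nhds)
  qed
  assume "None \<in> psl2_act g -` S"
  then show "eventually (\<lambda>z. Some z \<in> psl2_act g -` S) at_infinity"
    using psl2_act_tendsto[OF assms, of g None] by simp
qed

lemma psl2_act_image_iff: "x \<in> psl2_act (inverse p) ` D \<longleftrightarrow> psl2_act p x \<in> D"
proof
  assume "psl2_act p x \<in> D"
  then show "x \<in> psl2_act (inverse p) ` D"
    by (intro image_eqI[of _ _ "psl2_act p x"]) simp_all
qed auto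

lemma openin_psl2_act_image:
  assumes "openin sphere_top S"
  shows "openin sphere_top (psl2_act g ` S)"
proof -
  have "psl2_act (inverse g) -` S = psl2_act g ` S"
    by (auto simp: image_iff) (metis psl2_act_inverse)
  then show ?thesis
    using openin_psl2_act_vimage[OF assms, of "inverse g"] by simp
qed

lemma insert_None_range_Some [simp]: "insert None (range Some) = UNIV"
  by (metis UNIV_option_conv)

lemma topspace_sphere: "topspace sphere_top = UNIV"
  by simp

lemma homeomorphic_map_psl2_act: "homeomorphic_map sphere_top sphere_top (psl2_act g)"
proof -
  have "continuous_map sphere_top sphere_top (psl2_act h)" for h
    using openin_psl2_act_vimage by (auto simp: continuous_map_def vimage_def)
  then have "homeomorphic_maps sphere_top sphere_top (psl2_act g) (psl2_act (inverse g))"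
    by (simp add: homeomorphic_maps_def)
  then show ?thesis
    by (auto simp: homeomorphic_map_maps)
qed

lemma psl2_act_closure_of:
  "psl2_act g ` (sphere_top closure_of D) = sphere_top closure_of (psl2_act g ` D)"
  using homeomorphic_map_closure_of[OF homeomorphic_map_psl2_act, of D g] by simp

lemma psl2_act_interior_of:
  "psl2_act g ` (sphere_top interior_of D) = sphere_top interior_of (psl2_act g ` D)"
  using homeomorphic_map_interior_of[OF homeomorphic_map_psl2_act, of D g] by simp

lemma sphere_closure_of_ball:
  assumes "r > 0"
  shows "sphere_top closure_of (Some ` ball (c :: complex) r) = Some ` cball c r"
proof (rule antisym)
  have "closedin sphere_top (Some ` cball c r)"
    by (subst closedin_Alexandroff_compactification_image_Some) (simp add: compact_imp_closed)
  then show "sphere_top closure_of (Some ` ball c r) \<subseteq> Some ` cball c r"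
    by (intro closure_of_minimal) auto
  show "Some ` cball c r \<subseteq> sphere_top closure_of (Some ` ball c r)"
    using continuous_map_image_closure_subset[OF continuous_map_Some, of euclidean "ball c r"] assms
    by (simp add: closure_ball)
qed

lemma sphere_interior_of_cball:
  assumes "r > 0"
  shows "sphere_top interior_of (Some ` cball (c :: complex) r) = Some ` ball c r"
proof (rule antisym)
  have "openin sphere_top (Some ` ball c r)"
    by simp
  then show "Some ` ball c r \<subseteq> sphere_top interior_of (Some ` cball c r)"
    by (intro interior_of_maximal) auto
  define W where "W = sphere_top interior_of (Some ` cball c r)"
  have "openin sphere_top W" "W \<subseteq> Some ` cball c r"
    unfolding W_def by (simp_all add: interior_of_subset)
  then have "open {z. Some z \<in> W}" "{z. Some z \<in> W} \<subseteq> cball c r"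
    by (auto simp: openin_sphere_iff)
  then have "{z. Some z \<in> W} \<subseteq> ball c r"
    by (metis interior_cball interior_maximal)
  then show "W \<subseteq> Some ` ball c r"
    using \<open>W \<subseteq> Some ` cball c r\<close> by blast
qed

lemma real_disk_chart:
  assumes "real_disk D"
  obtains g c r where "r > 0" "D = psl2_act (inverse g) ` Some ` ball (complex_of_real c) r"
    "psl2_act g ` D = Some ` ball (complex_of_real c) r"
proof -
  obtain g c r where *: "r > 0" "psl2_act g ` D = Some ` ball (complex_of_real c) r"
    using assms unfolding real_disk_def by blast
  then have "D = psl2_act (inverse g) ` Some ` ball (complex_of_real c) r"
    by (simp add: image_image flip: *(2))
  then show ?thesis using * that by blast
qed

text \<open>All three facts are transported from a round disk of the plane by the homeomorphisms of the
sphere. The last one, regularity of the disk as an open set, is needed to recover \<open>\<D>\<^sub>1\<close> from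
the complement of its closure.\<close>

lemma real_disk_openin:
  assumes "real_disk D"
  shows "openin sphere_top D" "D \<noteq> {}" "sphere_top interior_of (sphere_top closure_of D) = D"
proof -
  obtain g c r where r: "r > 0" and D: "D = psl2_act (inverse g) ` Some ` ball (complex_of_real c) r"
    using real_disk_chart[OF assms] .
  show "sphere_top interior_of (sphere_top closure_of D) = D"
    unfolding D using r
    by (simp add: sphere_closure_of_ball sphere_interior_of_cball flip: psl2_act_interior_of psl2_act_closure_of)
  then show "openin sphere_top D"
    by (metis openin_interior_of)
  show "D \<noteq> {}" using D r by simp
qed

text \<open>A real disk is symmetric under complex conjugation, hence so is its image under \<open>q\<close>, and a round
disk that is symmetric has a real center. So the principal branch of the weight is the right one
in every bounded chart.\<close>

lemma real_disk_chart_center_real: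
  assumes "real_disk D" and q: "psl2_act q ` D = Some ` ball c r" and "r > 0"
  obtains x where "c = complex_of_real x"
proof -
  obtain g c' r' where g: "D = psl2_act (inverse g) ` Some ` ball (complex_of_real c') r'"
    using real_disk_chart[OF assms(1)] .
  have "ball (cnj c) r \<subseteq> ball c r"
  proof
    fix z assume "z \<in> ball (cnj c) r"
    then have "cnj z \<in> ball c r"
      by (metis complex_cnj_cnj complex_cnj_diff complex_mod_cnj dist_norm mem_ball)
    then have "Some (cnj z) \<in> psl2_act q ` psl2_act (inverse g) ` Some ` ball (of_real c') r'"
      using q g by blast
    then obtain w where w: "w \<in> ball (of_real c') r'" "Some (cnj z) = psl2_act (q * inverse g) (Some w)"
      by (auto simp: psl2_act_mult)
    have "cmod (of_real c' - cnj w) = cmod (of_real c' - w)"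
      by (metis complex_cnj_complex_of_real complex_cnj_diff complex_mod_cnj)
    then have w': "cnj w \<in> ball (of_real c') r'"
      using w(1) by (simp add: dist_norm)
    have "psl2_act (q * inverse g) (Some (cnj w)) = Some z"
      using psl2_act_cnj[of "q * inverse g" "Some w"] w(2) by (metis complex_cnj_cnj option.simps(9))
    then have "Some z \<in> psl2_act q ` D"
      unfolding g using w' by (force simp: psl2_act_mult image_iff)
    then show "z \<in> ball c r" using q by auto
  qed
  then have "cnj c = c"
    using \<open>r > 0\<close> by (auto simp: ball_subset_ball_iff)
  then show ?thesis
    using that by (metis Reals_cnj_iff Reals_cases)
qed

section \<open>The generator of a Schottky data is hyperbolic\<close>

text \<open>The closure of \<open>\<D>\<^sub>-\<^sub>1\<close> lies in the exterior of \<open>\<D>\<^sub>1\<close>, which \<open>S\<^sub>1\<close> maps into \<open>\<D>\<^sub>-\<^sub>1\<close>.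
For the inverse take complements: \<open>S\<^sub>1\<^sup>-\<^sup>1\<close> maps the complement of \<open>\<D>\<^sub>-\<^sub>1\<close> onto the closure of
\<open>\<D>\<^sub>1\<close>, hence its interior into the interior of that closure, which is \<open>\<D>\<^sub>1\<close>.\<close>

lemma schottky_data_contracting:
  assumes "schottky_data l D1 Dm1 S1"
  shows "psl2_act S1 ` (sphere_top closure_of Dm1) \<subseteq> Dm1"
    and "psl2_act (inverse S1) ` (sphere_top closure_of D1) \<subseteq> D1"
proof -
  note disks = assms[unfolded schottky_data_def]
  have d1: "real_disk D1" and dm1: "real_disk Dm1"
    and disj: "(sphere_top closure_of D1) \<inter> (sphere_top closure_of Dm1) = {}"
    and S1: "psl2_act S1 ` (UNIV - sphere_top closure_of D1) = Dm1"
    using disks real_disk_openin(1)[of Dm1] by (simp_all add: interior_of_openin)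
  show "psl2_act S1 ` (sphere_top closure_of Dm1) \<subseteq> Dm1"
    using disj S1 by blast
  have "psl2_act (inverse S1) ` (UNIV - Dm1) \<subseteq> sphere_top closure_of D1"
  proof
    fix x assume "x \<in> psl2_act (inverse S1) ` (UNIV - Dm1)"
    then have "psl2_act S1 x \<notin> Dm1" by auto
    then show "x \<in> sphere_top closure_of D1" using S1 by blast
  qed
  then have "sphere_top interior_of (psl2_act (inverse S1) ` (UNIV - Dm1)) \<subseteq> D1"
    using interior_of_mono real_disk_openin(3)[OF d1] by metis
  moreover have "sphere_top closure_of D1 \<subseteq> sphere_top interior_of (UNIV - Dm1)"
    using disj closure_of_subset[of Dm1 sphere_top]
    by (auto simp: interior_of_closure_of Diff_Diff_Int)
  ultimately show "psl2_act (inverse S1) ` (sphere_top closure_of D1) \<subseteq> D1"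
    by (auto simp: simp flip: psl2_act_interior_of)
qed

text \<open>In a bounded chart the element maps a closed real interval, the diameter of the disk, continuously
into itself, so the fixed point theorem in dimension one already gives a fixed point, and a real
one.\<close>

lemma contracting_disk_fixed_point:
  assumes "real_disk D" and contr: "psl2_act g ` (sphere_top closure_of D) \<subseteq> D"
  obtains x where "x \<in> D" "psl2_act g x = x" "map_option cnj x = x"
proof -
  obtain m c r where r: "r > 0" and D: "D = psl2_act (inverse m) ` Some ` ball (complex_of_real c) r"
    and mD: "psl2_act m ` D = Some ` ball (complex_of_real c) r"
    using real_disk_chart[OF assms(1)] .
  define h where "h = m * g * inverse m"
  have "psl2_act h ` Some ` cball (of_real c) r = psl2_act m ` psl2_act g ` (sphere_top closure_of D)"
    unfolding h_def psl2_act_image_mult D using r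
    by (simp add: sphere_closure_of_ball flip: psl2_act_closure_of)
  then have h: "psl2_act h ` Some ` cball (of_real c) r \<subseteq> Some ` ball (of_real c) r"
    using contr mD by (metis image_mono)
  define I where "I = {c - r..c + r}"
  have I: "complex_of_real t \<in> cball (of_real c) r \<longleftrightarrow> t \<in> I" for t
    by (simp add: I_def dist_norm flip: of_real_diff) (auto simp: abs_if)
  have hI: "psl2_act h (Some (of_real t)) = Some (moebius h (of_real t))"
       "moebius h (of_real t) \<in> cball (of_real c) r"
       "moebius h (of_real t) = of_real (Re (moebius h (of_real t)))" if "t \<in> I" for t
  proof -
    have *: "psl2_act h (Some (of_real t)) \<in> Some ` ball (of_real c) r"
      using h I[of t] that by blast
    then show eq: "psl2_act h (Some (of_real t)) = Some (moebius h (of_real t))"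
      by (intro psl2_act_Some_moebius) auto
    show "moebius h (of_real t) \<in> cball (of_real c) r"
      using * eq by auto
    have "cnj (moebius h (of_real t)) = moebius h (of_real t)"
      using psl2_act_cnj[of h "Some (of_real t)"] eq by simp
    then show "moebius h (of_real t) = of_real (Re (moebius h (of_real t)))"
      by (simp add: complex_eq_iff)
  qed
  define \<phi> where "\<phi> = (\<lambda>t. Re (moebius h (of_real t)))"
  have "continuous_on I \<phi>"
  proof -
    obtain a' b' c' d' where hm: "h = psl2_mat a' b' c' d'" and det: "a' * d' - b' * c' = 1" by (rule psl2_cases)
    have "complex_of_real c' * of_real t + of_real d' \<noteq> 0" if "t \<in> I" for t
      using hI(1)[OF that] by (auto simp: hm psl2_act_psl2_mat[OF det] split: if_splits)
    then show ?thesis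
      unfolding \<phi>_def hm moebius_psl2_mat[OF det] by (intro continuous_intros) auto
  qed
  moreover have "\<phi> \<in> I \<rightarrow> I"
  proof (rule Pi_I)
    fix t assume "t \<in> I"
    then have "complex_of_real (\<phi> t) \<in> cball (of_real c) r"
      using hI(2,3) by (metis \<phi>_def)
    then show "\<phi> t \<in> I" by (simp only: I)
  qed
  moreover have "compact I" "convex I" "I \<noteq> {}"
    using r by (auto simp: I_def)
  ultimately obtain t where t: "t \<in> I" "\<phi> t = t"
    using brouwer[of I \<phi>] by metis
  then have fixt: "psl2_act h (Some (of_real t)) = Some (of_real t)"
    using hI(1,3)[OF t(1)] by (simp add: \<phi>_def)
  define x where "x = psl2_act (inverse m) (Some (of_real t))"
  have gx: "psl2_act g x = x"
  proof -
    have "psl2_act g x = psl2_act (inverse m) (psl2_act h (Some (of_real t)))"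
      by (simp add: h_def x_def psl2_act_mult)
    then show ?thesis by (simp add: fixt x_def)
  qed
  have "Some (of_real t) \<in> Some ` ball (complex_of_real c) r"
    using h fixt I[of t] t(1) by (metis imageI subsetD)
  then have "x \<in> D"
    unfolding x_def D by blast
  moreover have "map_option cnj x = x"
    using psl2_act_cnj[of "inverse m" "Some (of_real t)"] by (simp add: x_def)
  ultimately show ?thesis using gx that by blast
qed

lemma real_pair_from_zero_infinity:
  assumes "map_option cnj x = x" "map_option cnj y = y" "x \<noteq> y"
  obtains p where "psl2_act p (Some 0) = x" "psl2_act p None = y"
proof -
  have real: "\<exists>t. z = complex_of_real t" if "map_option cnj (Some z) = Some z" for z
    using that by (metis Reals_cases Reals_cnj_iff option.inject option.simps(9))
  consider t where "x = Some (complex_of_real t)" "y = None"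
    | u where "x = None" "y = Some (complex_of_real u)"
    | t u where "x = Some (complex_of_real t)" "y = Some (complex_of_real u)" "t \<noteq> u"
    using assms real by (cases x; cases y) (auto, metis)
  then show ?thesis
  proof cases
    case 1
    then show ?thesis
      using that[of "psl2_mat 1 t 0 1"] by (simp add: psl2_act_psl2_mat)
  next
    case 2
    then show ?thesis
      using that[of "psl2_mat u (-1) 1 0"] by (simp add: psl2_act_psl2_mat)
  next
    case 3
    have "(u - t) / (u - t) = 1"
      using 3(3) by simp
    then have det: "(u / (u - t)) * 1 - t * (1 / (u - t)) = 1"
      unfolding diff_divide_distrib by (simp del: divide_self_if)
    then show ?thesis
      using that[of "psl2_mat (u / (u - t)) t (1 / (u - t)) 1"] 3
      by (simp add: psl2_act_psl2_mat[OF det] flip: of_real_diff of_real_divide)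
  qed
qed

text \<open>Fixing \<open>0\<close> and \<open>\<infinity>\<close> makes the matrix diagonal; it may be replaced by its negative to make
the diagonal positive.\<close>

lemma psl2_fixing_zero_infinity:
  assumes "psl2_act h (Some 0) = Some 0" "psl2_act h None = None"
  obtains L where "h = a_elem L"
proof -
  obtain a b c d where h: "h = psl2_mat a b c d" and det: "a * d - b * c = 1" by (rule psl2_cases)
  have c: "c = 0" and b: "b = 0"
    using assms det by (auto simp: h psl2_act_psl2_mat[OF det] split: if_splits)
  have diag: "psl2_mat e 0 0 (1 / e) = a_elem (2 * ln e)" if "e > 0" for e
    unfolding a_elem_def using that by (simp add: exp_minus inverse_eq_divide)
  have "a \<noteq> 0"
    using det b c by auto
  with det b c have a: "a \<noteq> 0" "d = 1 / a"
    by (auto simp: nonzero_eq_divide_eq mult.commute)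
  show ?thesis
  proof (cases "a > 0")
    case True
    then show ?thesis using that diag[of a] by (simp add: h a b c)
  next
    case False
    then have "h = psl2_mat (- a) 0 0 (1 / (- a))"
      using psl2_mat_uminus[OF det] by (simp add: h a b c)
    then show ?thesis using that diag[of "- a"] False a by simp
  qed
qed

text \<open>In the coordinate where \<open>p\<close> is the identity, the closure of the disk is a compact set \<open>K\<close> of the
plane around \<open>0\<close> that multiplication by \<open>e\<^sup>-\<^sup>L\<close> maps into its interior. If \<open>L \<le> 0\<close>, a point of
\<open>K\<close> of maximal modulus would be mapped to an interior point of at least that modulus.\<close>

lemma conj_translation_length_pos:
  assumes D: "openin sphere_top D" and g: "g = p * a_elem L * inverse p"
    and contr: "psl2_act (inverse g) ` (sphere_top closure_of D) \<subseteq> D"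
    and zero: "psl2_act p (Some 0) \<in> D" and infinity: "psl2_act p None \<notin> sphere_top closure_of D"
  shows "L > 0"
proof (rule ccontr)
  assume "\<not> L > 0"
  define U where "U = psl2_act (inverse p) ` D"
  have U_eq: "x \<in> U \<longleftrightarrow> psl2_act p x \<in> D" for x
    unfolding U_def by (rule psl2_act_image_iff)
  have clU_eq: "x \<in> sphere_top closure_of U \<longleftrightarrow> psl2_act p x \<in> sphere_top closure_of D" for x
    unfolding U_def psl2_act_closure_of[symmetric] by (rule psl2_act_image_iff)
  define V where "V = {z. Some z \<in> U}"
  define K where "K = {z. Some z \<in> sphere_top closure_of U}"
  have "openin sphere_top U"
    unfolding U_def using D by (intro openin_psl2_act_image)
  then have "open V" by (simp add: V_def openin_sphere_iff)
  have "V \<subseteq> K" using closure_of_subset[of U sphere_top] by (auto simp: V_def K_def)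
  have "openin sphere_top (UNIV - sphere_top closure_of U)"
    by (metis closedin_closure_of closedin_def topspace_sphere)
  moreover have "None \<notin> sphere_top closure_of U"
    using infinity by (simp add: clU_eq)
  ultimately have "open (- K)" "eventually (\<lambda>z. z \<notin> K) at_infinity"
    by (simp_all add: openin_sphere_iff K_def Collect_neg_eq)
  then have "compact K"
    by (force simp: compact_eq_bounded_closed closed_def eventually_at_infinity bounded_iff not_le
      intro: less_imp_le)
  moreover have "0 \<in> K"
    using zero closure_of_subset[of D sphere_top] by (auto simp: K_def clU_eq)
  ultimately obtain z where z: "z \<in> K" "\<And>w. w \<in> K \<Longrightarrow> norm w \<le> norm z"
    using continuous_attains_sup[of K norm] continuous_on_norm_id by blast
  \<comment> \<open>An open subset of a closed disk lies in the open disk.\<close>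
  have "V \<subseteq> cball 0 (norm z)"
    using z(2) \<open>V \<subseteq> K\<close> by auto
  then have "V \<subseteq> ball 0 (norm z)"
    using \<open>open V\<close> by (metis interior_cball interior_maximal)
  moreover have "of_real (exp (- L)) * z \<in> V"
  proof -
    have "psl2_act (inverse g) (psl2_act p (Some z)) = psl2_act p (psl2_act (a_elem (- L)) (Some z))"
      by (simp add: g psl2_inverse_mult psl2_act_mult a_elem_inverse)
    moreover have "psl2_act p (Some z) \<in> sphere_top closure_of D"
      using z(1) by (simp add: K_def clU_eq)
    ultimately show ?thesis
      using contr by (auto simp: V_def U_eq a_elem_act)
  qed
  ultimately have "exp (- L) * norm z < norm z"
    by (auto simp: norm_mult)
  moreover have "1 * norm z \<le> exp (- L) * norm z"
    using \<open>\<not> L > 0\<close> by (intro mult_right_mono) auto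
  ultimately show False by simp
qed

text \<open>Iterating \<open>g\<^sup>-\<^sup>1\<close> from any point of \<open>D\<close> other than the attracting fixed point of \<open>g\<close> converges to
the repelling fixed point \<open>p.0\<close> of \<open>g\<close>. So \<open>p.0\<close> lies in the closure of \<open>D\<close>, and as
\<open>g\<^sup>-\<^sup>1\<close> fixes it and maps the closure into \<open>D\<close>, it lies in \<open>D\<close>.\<close>

lemma contracting_contains_fixed_point:
  assumes D: "openin sphere_top D" "D \<noteq> {}" and g: "g = p * a_elem L * inverse p" and L: "L > 0"
    and contr: "psl2_act (inverse g) ` (sphere_top closure_of D) \<subseteq> D"
  shows "psl2_act p (Some 0) \<in> D"
proof -
  define U where "U = psl2_act (inverse p) ` D"
  have U_eq: "x \<in> U \<longleftrightarrow> psl2_act p x \<in> D" for x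
    unfolding U_def by (rule psl2_act_image_iff)
  have clU_eq: "x \<in> sphere_top closure_of U \<longleftrightarrow> psl2_act p x \<in> sphere_top closure_of D" for x
    unfolding U_def psl2_act_closure_of[symmetric] by (rule psl2_act_image_iff)
  have step: "psl2_act (a_elem (- L)) x \<in> U" if "x \<in> sphere_top closure_of U" for x
  proof -
    have "psl2_act (inverse g) (psl2_act p x) = psl2_act p (psl2_act (a_elem (- L)) x)"
      by (simp add: g psl2_inverse_mult psl2_act_mult a_elem_inverse)
    then show ?thesis using contr that by (auto simp: U_eq clU_eq)
  qed
  have sub: "U \<subseteq> sphere_top closure_of U"
    by (rule closure_of_subset) simp
  have "openin sphere_top U"
    unfolding U_def using D by (intro openin_psl2_act_image)
  moreover have "U \<noteq> {}" using D by (simp add: U_def)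
  ultimately obtain w where w: "Some w \<in> U"
  proof (cases "None \<in> U")
    case True
    then obtain b where "\<forall>z. norm z \<ge> b \<longrightarrow> Some (z :: complex) \<in> U"
      using \<open>openin sphere_top U\<close> by (auto simp: openin_sphere_iff eventually_at_infinity)
    then show ?thesis using that[of "of_real \<bar>b\<bar>"] by simp
  next
    case False
    then show ?thesis using that \<open>U \<noteq> {}\<close> by (metis ex_in_conv not_None_eq)
  qed
  have iter: "Some (of_real (exp (- L) ^ k) * w) \<in> U" for k
  proof (induction k)
    case (Suc k)
    then show ?case
      using step[of "Some (of_real (exp (- L) ^ k) * w)"] sub
      by (auto simp: a_elem_act mult.assoc simp del: of_real_power)
  qed (simp add: w)
  have "Some 0 \<in> sphere_top closure_of U"
  proof (rule ccontr)
    assume "Some 0 \<notin> sphere_top closure_of U"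
    moreover have "openin sphere_top (UNIV - sphere_top closure_of U)"
      by (metis closedin_closure_of closedin_def topspace_sphere)
    ultimately have "open {z. Some z \<notin> sphere_top closure_of U}" "0 \<in> {z. Some z \<notin> sphere_top closure_of U}"
      by (simp_all add: openin_sphere_iff)
    moreover have "(\<lambda>k. of_real (exp (- L) ^ k) * w) \<longlonglongrightarrow> of_real 0 * w"
      using L by (intro tendsto_mult tendsto_of_real LIMSEQ_realpow_zero tendsto_const) auto
    ultimately have "eventually (\<lambda>k. of_real (exp (- L) ^ k) * w \<in> {z. Some z \<notin> sphere_top closure_of U}) sequentially"
      by (intro topological_tendstoD) auto
    then show False using iter sub by (auto dest!: eventually_happens)
  qed
  from step[OF this] show ?thesis by (simp add: a_elem_act U_eq)
qed

lemma conj_inverse_S_elem: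
  assumes "g = p * a_elem L * inverse p"
  shows "inverse g = (p * S_elem) * a_elem L * inverse (p * S_elem)"
proof -
  have "(p * S_elem) * a_elem L * inverse (p * S_elem) = p * (S_elem * a_elem L * inverse S_elem) * inverse p"
    by (simp add: psl2_inverse_mult mult.assoc)
  also have "\<dots> = inverse g"
    unfolding S_elem_conj by (simp add: assms psl2_inverse_mult a_elem_inverse mult.assoc)
  finally show ?thesis by simp
qed

lemma schottky_data_fixed_points:
  assumes data: "schottky_data l D1 Dm1 S1" and S1: "S1 = p * a_elem L * inverse p" and "L > 0"
  shows "psl2_act p (Some 0) \<in> D1" "psl2_act p None \<in> Dm1"
proof -
  have disks: "real_disk D1" "real_disk Dm1"
    using data by (auto simp: schottky_data_def)
  show "psl2_act p (Some 0) \<in> D1"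
    using contracting_contains_fixed_point[OF real_disk_openin(1,2)[OF disks(1)] S1 \<open>L > 0\<close>]
      schottky_data_contracting(2)[OF data] .
  have "psl2_act (p * S_elem) (Some 0) \<in> Dm1"
    using contracting_contains_fixed_point[OF real_disk_openin(1,2)[OF disks(2)]
      conj_inverse_S_elem[OF S1] \<open>L > 0\<close>] schottky_data_contracting(1)[OF data] by simp
  then show "psl2_act p None \<in> Dm1"
    by (simp add: psl2_act_mult S_elem_act)
qed

text \<open>The two real fixed points are distinct because the disks are disjoint. Moving them to \<open>0\<close> and \<open>\<infinity>\<close>
makes \<open>S\<^sub>1\<close> diagonal, and the contraction of \<open>\<D>\<^sub>1\<close> decides the sign of the translation length.\<close>

lemma schottky_data_hyperbolic:
  assumes data: "schottky_data l D1 Dm1 S1"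
  obtains p L where "L > 0" "S1 = p * a_elem L * inverse p"
proof -
  have disks: "real_disk D1" "real_disk Dm1"
    and disj: "(sphere_top closure_of D1) \<inter> (sphere_top closure_of Dm1) = {}"
    using data by (auto simp: schottky_data_def)
  note contr = schottky_data_contracting[OF data]
  obtain x where x: "x \<in> D1" "psl2_act (inverse S1) x = x" "map_option cnj x = x"
    using contracting_disk_fixed_point[OF disks(1) contr(2)] .
  obtain y where y: "y \<in> Dm1" "psl2_act S1 y = y" "map_option cnj y = y"
    using contracting_disk_fixed_point[OF disks(2) contr(1)] .
  have y_cl: "y \<notin> sphere_top closure_of D1"
    using y(1) disj closure_of_subset[of Dm1 sphere_top] by auto
  have "x \<noteq> y"
    using x(1) y_cl closure_of_subset[of D1 sphere_top] by auto
  then obtain p where p: "psl2_act p (Some 0) = x" "psl2_act p None = y"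
    using real_pair_from_zero_infinity[OF x(3) y(3)] by blast
  have "psl2_act S1 x = x"
    using x(2) by (metis psl2_act_inverse(2))
  then have "psl2_act (inverse p * S1 * p) (Some 0) = Some 0" "psl2_act (inverse p * S1 * p) None = None"
    using p y(2) by (simp_all add: psl2_act_mult) (metis psl2_act_inverse(1))+
  then obtain L where L: "inverse p * S1 * p = a_elem L"
    by (rule psl2_fixing_zero_infinity)
  have "S1 = (p * inverse p) * S1 * (p * inverse p)" by simp
  also have "\<dots> = p * (inverse p * S1 * p) * inverse p" by (simp only: mult.assoc)
  finally have S1: "S1 = p * a_elem L * inverse p" by (simp only: L)
  have "L > 0"
    using conj_translation_length_pos[OF real_disk_openin(1)[OF disks(1)] S1 contr(2)] p x(1) y_cl by simp
  then show ?thesis using S1 that by blast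
qed

section \<open>The length of a hyperbolic cylinder is a metric invariant\<close>

lemma moebius_upper_half_plane:
  assumes "z \<in> upper_half_plane"
  shows "moebius g z \<in> upper_half_plane"
    and "psl2_act g (Some z) = Some (moebius g z)"
proof -
  obtain a b c d where g: "g = psl2_mat a b c d" and det: "a * d - b * c = 1" by (rule psl2_cases)
  define M where "M = complex_of_real c * z + of_real d"
  have "M \<noteq> 0"
  proof
    assume M0: "M = 0"
    have "Im M = c * Im z" by (simp add: M_def)
    with M0 have "c = 0" using assms by (simp add: upper_half_plane_def)
    moreover have "M = of_real d" using \<open>c = 0\<close> by (simp add: M_def)
    ultimately show False using M0 det by simp
  qed
  then show "psl2_act g (Some z) = Some (moebius g z)"
    by (simp add: g psl2_act_psl2_mat[OF det] moebius_psl2_mat[OF det] M_def)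
  have "Im ((of_real a * z + of_real b) * cnj M) = (a * d - b * c) * Im z"
    by (simp add: M_def algebra_simps)
  then have "Im ((of_real a * z + of_real b) / M) = Im z / (cmod M)\<^sup>2"
    using det by (simp add: Im_complex_div_eq_0 complex_div_cnj[of _ M] flip: of_real_power)
  then show "moebius g z \<in> upper_half_plane"
    using assms \<open>M \<noteq> 0\<close> by (simp add: g moebius_psl2_mat[OF det] upper_half_plane_def flip: M_def)
qed

lemma moebius_mult_upper_half_plane:
  assumes "z \<in> upper_half_plane"
  shows "moebius (g * h) z = moebius g (moebius h z)"
  using psl2_act_mult[of g h "Some z"] moebius_upper_half_plane[OF assms]
    moebius_upper_half_plane(2)[OF moebius_upper_half_plane(1)[OF assms]] by simp

lemma moebius_one: "moebius 1 z = z"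
  using psl2_act_Some_moebius[of 1 z] by simp

lemma hyp_dist_moebius:
  assumes "z \<in> upper_half_plane" "w \<in> upper_half_plane"
  shows "hyp_dist (moebius g z) (moebius g w) = hyp_dist z w"
proof -
  obtain a b c d where g: "g = psl2_mat a b c d" and det: "a * d - b * c = 1" by (rule psl2_cases)
  define M where "M = (\<lambda>z. complex_of_real c * z + of_real d)"
  define N where "N = (\<lambda>z. complex_of_real a * z + of_real b)"
  have gNM: "moebius g u = N u / M u" for u
    by (simp add: g moebius_psl2_mat[OF det] N_def M_def)
  have M0: "M u \<noteq> 0" if "u \<in> upper_half_plane" for u
    using moebius_upper_half_plane(2)[OF that, of g]
    by (auto simp: g psl2_act_psl2_mat[OF det] M_def split: if_splits)
  have im: "Im (moebius g u) = Im u / (cmod (M u))\<^sup>2" for u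
  proof -
    have "Im (N u * cnj (M u)) = (a * d - b * c) * Im u"
      by (simp add: M_def N_def algebra_simps)
    then show ?thesis
      using det by (simp add: gNM complex_div_cnj[of _ "M u"] flip: of_real_power)
  qed
  have "N z * M w - N w * M z = (of_real a * of_real d - of_real b * of_real c) * (z - w)"
    by (simp add: M_def N_def algebra_simps)
  then have "N z * M w - N w * M z = z - w"
    using det_complex[OF det] by simp
  then have "moebius g z - moebius g w = (z - w) / (M z * M w)"
    using M0 assms by (simp add: gNM field_simps)
  then have "(cmod (moebius g z - moebius g w))\<^sup>2 = (cmod (z - w))\<^sup>2 / ((cmod (M z))\<^sup>2 * (cmod (M w))\<^sup>2)"
    by (simp add: norm_divide norm_mult power_divide power_mult_distrib)
  then have "(cmod (moebius g z - moebius g w))\<^sup>2 / (2 * Im (moebius g z) * Im (moebius g w)) =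
      (cmod (z - w))\<^sup>2 / (2 * Im z * Im w)"
    unfolding im using M0 assms by (simp add: field_simps)
  then show ?thesis
    by (simp add: hyp_dist_def)
qed

lemma hyp_dist_nonneg:
  assumes "z \<in> upper_half_plane" "w \<in> upper_half_plane"
  shows "hyp_dist z w \<ge> 0"
  using assms unfolding hyp_dist_def upper_half_plane_def by (intro arcosh_nonneg_real) simp

text \<open>In the coordinates \<open>(u, v, w) = (\<bar>z\<bar>\<^sup>2 / Im z, Re z / Im z, 1 / Im z)\<close> the upper half plane becomes one
sheet of the hyperboloid \<open>u w - v\<^sup>2 = 1\<close>, and the right-hand side is the polar form
\<open>(u w' + u' w) / 2 - v v'\<close> of the quadratic form.\<close>

lemma cosh_hyp_dist:
  assumes "z \<in> upper_half_plane" "w \<in> upper_half_plane"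
  shows "cosh (hyp_dist z w) = ((cmod z)\<^sup>2 + (cmod w)\<^sup>2 - 2 * Re z * Re w) / (2 * Im z * Im w)"
proof -
  have pos: "Im z > 0" "Im w > 0"
    using assms by (auto simp: upper_half_plane_def)
  have "cosh (hyp_dist z w) = 1 + (cmod (z - w))\<^sup>2 / (2 * Im z * Im w)"
    unfolding hyp_dist_def using pos by (intro cosh_arcosh_real) simp
  also have "(cmod (z - w))\<^sup>2 = (cmod z)\<^sup>2 + (cmod w)\<^sup>2 - 2 * Re z * Re w - 2 * Im z * Im w"
    unfolding cmod_power2 by (simp add: power2_eq_square algebra_simps)
  finally show ?thesis
    using pos by (simp add: field_simps)
qed

text \<open>The form \<open>u w - v\<^sup>2\<close> has signature \<open>(1, 2)\<close>. It is therefore negative definite on the orthogonal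
complement of a vector \<open>(p, q, t)\<close> on which it takes the value \<open>1\<close>.\<close>

lemma null_vector_orthogonal_to_timelike:
  fixes u v w p q t :: real
  assumes "p * t = 1 + q\<^sup>2" and "u * t + p * w = 2 * v * q" and "u * w \<ge> v\<^sup>2"
  shows "u = 0" "v = 0" "w = 0"
proof -
  have "(u * t - p * w)\<^sup>2 = (u * t + p * w)\<^sup>2 - 4 * (u * w) * (p * t)"
    by (simp add: power2_eq_square algebra_simps)
  also have "\<dots> = 4 * v\<^sup>2 * q\<^sup>2 - 4 * (u * w) * (1 + q\<^sup>2)"
    unfolding assms(1,2) by (simp add: power2_eq_square)
  also have "\<dots> \<le> 4 * v\<^sup>2 * q\<^sup>2 - 4 * v\<^sup>2 * (1 + q\<^sup>2)"
    using assms(3) by (intro diff_mono mult_right_mono) auto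
  finally have *: "(u * t - p * w)\<^sup>2 + 4 * v\<^sup>2 \<le> 0"
    by (simp add: algebra_simps)
  then have "v\<^sup>2 \<le> 0"
    using zero_le_power2[of "u * t - p * w"] by linarith
  then show "v = 0" by simp
  with * have "u * t - p * w = 0" by simp
  with assms(2) \<open>v = 0\<close> have "u * t = 0" "p * w = 0" by simp_all
  moreover have "p * t > 0" unfolding assms(1) by (simp add: add_pos_nonneg)
  ultimately show "u = 0" "w = 0" by auto
qed

text \<open>If \<open>X, Y, Z\<close> are the points of the hyperboloid belonging to \<open>x, y, z\<close>, then \<open>X + Y - 2 cosh a Z\<close> is
orthogonal to \<open>Z\<close>, while its square is \<open>2 + 2 cosh (d(x, y)) - 4 (cosh a)\<^sup>2 \<ge> 0\<close>. So it vanishes, and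
\<open>Z = (X + Y) / (2 cosh a)\<close>.\<close>

lemma hyperbolic_midpoint:
  assumes uhp: "x \<in> upper_half_plane" "y \<in> upper_half_plane" "z \<in> upper_half_plane"
    and xz: "hyp_dist x z = a" and zy: "hyp_dist z y = a" and xy: "hyp_dist x y \<ge> 2 * a"
  shows "hyp_dist x y = 2 * a"
    and "2 * cosh a * (1 / Im z) = 1 / Im x + 1 / Im y"
    and "2 * cosh a * (Re z / Im z) = Re x / Im x + Re y / Im y"
proof -
  define U where "U = (\<lambda>z. (cmod z)\<^sup>2 / Im z)"
  define V where "V = (\<lambda>z. Re z / Im z)"
  define W where "W = (\<lambda>z. 1 / Im z)"
  have quad: "U z * W z = 1 + (V z)\<^sup>2" if "z \<in> upper_half_plane" for z
    using that unfolding U_def V_def W_def upper_half_plane_def cmod_power2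
    by (simp add: field_simps power2_eq_square)
  have bil: "U z * W w + U w * W z - 2 * V z * V w = 2 * cosh (hyp_dist z w)"
    if "z \<in> upper_half_plane" "w \<in> upper_half_plane" for z w
    using that unfolding cosh_hyp_dist[OF that]
    by (simp add: U_def V_def W_def upper_half_plane_def field_simps)
  define C where "C = cosh a"
  define D where "D = cosh (hyp_dist x y)"
  have "a \<ge> 0" using xz hyp_dist_nonneg uhp by metis
  then have "cosh (2 * a) \<le> D"
    unfolding D_def using xy by (subst cosh_real_nonneg_le_iff) auto
  then have D: "2 * C\<^sup>2 - 1 \<le> D"
    by (simp add: cosh_double_cosh C_def)
  note Qx = quad[OF uhp(1)] and Qy = quad[OF uhp(2)] and Qz = quad[OF uhp(3)]
  have Bxy: "U x * W y + U y * W x - 2 * V x * V y = 2 * D"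
    using bil[OF uhp(1,2)] by (simp add: D_def)
  have Bxz: "U x * W z + U z * W x - 2 * V x * V z = 2 * C"
    using bil[OF uhp(1,3)] by (simp add: C_def xz)
  have Byz: "U y * W z + U z * W y - 2 * V y * V z = 2 * C"
    using bil[OF uhp(3,2)] by (simp add: C_def zy algebra_simps)
  define u where "u = U x + U y - 2 * C * U z"
  define v where "v = V x + V y - 2 * C * V z"
  define w where "w = W x + W y - 2 * C * W z"
  \<comment> \<open>\<open>(u, v, w)\<close> is the vector \<open>X + Y - 2 cosh a Z\<close>.\<close>
  have orth: "u * W z + U z * w = 2 * v * V z"
  proof -
    have "u * W z + U z * w - 2 * v * V z = (U x * W z + U z * W x - 2 * V x * V z)
       + (U y * W z + U z * W y - 2 * V y * V z) - 4 * C * (U z * W z - (V z)\<^sup>2)"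
      by (simp add: u_def v_def w_def algebra_simps power2_eq_square)
    then show ?thesis using Bxz Byz Qz by simp
  qed
  have norm: "u * w - v\<^sup>2 = 2 + 2 * D - 4 * C\<^sup>2"
  proof -
    have "u * w - v\<^sup>2 = (U x * W x - (V x)\<^sup>2) + (U y * W y - (V y)\<^sup>2) + 4 * C\<^sup>2 * (U z * W z - (V z)\<^sup>2)
       + (U x * W y + U y * W x - 2 * V x * V y)
       - 2 * C * (U x * W z + U z * W x - 2 * V x * V z)
       - 2 * C * (U y * W z + U z * W y - 2 * V y * V z)"
      by (simp add: u_def v_def w_def algebra_simps power2_eq_square)
    then show ?thesis using Bxy Bxz Byz Qx Qy Qz by (simp add: power2_eq_square)
  qed
  then have "u * w \<ge> v\<^sup>2"
    using D by simp
  note null = null_vector_orthogonal_to_timelike[OF Qz orth this]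
  then have "D = cosh (2 * a)"
    using norm by (simp add: cosh_double_cosh C_def)
  then show "hyp_dist x y = 2 * a"
    using \<open>a \<ge> 0\<close> hyp_dist_nonneg[OF uhp(1,2)] cosh_real_nonneg_le_iff
    by (metis D_def antisym mult_nonneg_nonneg order_refl zero_le_numeral)
  show "2 * cosh a * (1 / Im z) = 1 / Im x + 1 / Im y"
    "2 * cosh a * (Re z / Im z) = Re x / Im x + Re y / Im y"
    using null by (simp_all add: v_def w_def V_def W_def C_def)
qed

lemma hyperbolic_midpoint_unique:
  assumes "x \<in> upper_half_plane" "y \<in> upper_half_plane" "z \<in> upper_half_plane" "z' \<in> upper_half_plane"
    and "hyp_dist x z = a" "hyp_dist z y = a" "hyp_dist x z' = a" "hyp_dist z' y = a"
    and "hyp_dist x y \<ge> 2 * a"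
  shows "z = z'"
proof -
  note m = hyperbolic_midpoint[OF assms(1,2,3,5,6,9)] hyperbolic_midpoint[OF assms(1,2,4,7,8,9)]
  have C: "2 * cosh a \<noteq> 0" by simp
  have "2 * cosh a * (1 / Im z) = 2 * cosh a * (1 / Im z')"
    using m(2,5) by simp
  then have "1 / Im z = 1 / Im z'"
    by (simp only: mult_left_cancel[OF C])
  then have im: "Im z = Im z'" by simp
  have "2 * cosh a * (Re z / Im z) = 2 * cosh a * (Re z' / Im z')"
    using m(3,6) by simp
  then have "Re z / Im z = Re z' / Im z'"
    by (simp only: mult_left_cancel[OF C])
  then have "Re z = Re z'"
    using im assms(4) by (simp add: upper_half_plane_def)
  with im show ?thesis by (simp add: complex_eq_iff)
qed

lemma a_elem_0: "a_elem 0 = 1"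
  by (simp add: a_elem_def psl2_mat_one)

lemma conj_a_elem_powi:
  assumes "g = p * a_elem L * inverse p"
  shows "g powi k = p * a_elem (of_int k * L) * inverse p"
proof -
  have pow: "(q * a_elem M * inverse q) ^ n = q * a_elem (of_nat n * M) * inverse q" for n :: nat and q M
  proof (induction n)
    case (Suc n)
    have "(q * a_elem M * inverse q) ^ Suc n = q * a_elem M * (inverse q * q) * a_elem (of_nat n * M) * inverse q"
      unfolding power_Suc Suc by (simp only: mult.assoc)
    also have "\<dots> = q * (a_elem M * a_elem (of_nat n * M)) * inverse q"
      by (simp add: mult.assoc)
    finally show ?case
      by (simp add: a_elem_add algebra_simps)
  qed (simp add: a_elem_0)
  have inv: "inverse g = p * a_elem (- L) * inverse p"
    by (simp add: assms psl2_inverse_mult a_elem_inverse mult.assoc)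
  show ?thesis
  proof (cases "k \<ge> 0")
    case True
    then show ?thesis
      unfolding power_int_def using pow[of p L "nat k"] by (simp add: assms)
  next
    case False
    then show ?thesis
      unfolding power_int_def using pow[of p "- L" "nat (- k)"] by (simp add: inv)
  qed
qed

lemma orbit_a_elem:
  "orbit (a_elem L) z = range (\<lambda>k :: int. of_real (exp (of_int k * L)) * z)"
proof -
  have "moebius (a_elem L powi k) z = of_real (exp (of_int k * L)) * z" for k
  proof -
    have "a_elem L powi k = a_elem (of_int k * L)"
      using conj_a_elem_powi[of "a_elem L" 1 L k] by simp
    moreover have "moebius (a_elem M) z = of_real (exp M) * z" for M
      using psl2_act_Some_moebius[of "a_elem M" z] by (simp add: a_elem_act)
    ultimately show ?thesis by simp
  qed
  then show ?thesis by (simp add: orbit_def)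
qed

text \<open>The map \<open>p\<close> is an isometry of the upper half plane and carries orbits of \<open>a\<^sub>L\<close> to orbits of
\<open>p a\<^sub>L p\<^sup>-\<^sup>1\<close>.\<close>

lemma isometric_quotients_conj:
  assumes g: "g = p * a_elem L * inverse p"
  shows "isometric_quotients (a_elem L) g"
proof -
  define F where "F = (\<lambda>A. moebius p ` A)"
  have orb: "orbit g (moebius p z) = F (orbit (a_elem L) z)" if "z \<in> upper_half_plane" for z
  proof -
    have "moebius (g powi k) (moebius p z) = moebius p (moebius (a_elem L powi k) z)" for k
    proof -
      have "a_elem L powi k = a_elem (of_int k * L)"
        using conj_a_elem_powi[of "a_elem L" 1 L k] by simp
      then have "(g powi k) * p = p * a_elem L powi k"
        by (simp add: conj_a_elem_powi[OF g] mult.assoc)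
      then show ?thesis
        using moebius_mult_upper_half_plane[OF that] by metis
    qed
    then show ?thesis by (simp add: orbit_def F_def image_image)
  qed
  have sub: "A \<subseteq> upper_half_plane" if "A \<in> cyclic_quotient (a_elem L)" for A
    using that by (auto simp: cyclic_quotient_def orbit_def moebius_upper_half_plane)
  have inv: "moebius (inverse p) (moebius p z) = z" "moebius p (moebius (inverse p) z) = z"
    if "z \<in> upper_half_plane" for z
    using moebius_mult_upper_half_plane[OF that, of "inverse p" p]
      moebius_mult_upper_half_plane[OF that, of p "inverse p"] by (simp_all add: moebius_one)
  have "inj_on F (cyclic_quotient (a_elem L))"
  proof (rule inj_on_inverseI)
    fix A assume "A \<in> cyclic_quotient (a_elem L)"
    then show "moebius (inverse p) ` F A = A"
      using sub inv by (force simp: F_def image_image)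
  qed
  moreover have "F ` cyclic_quotient (a_elem L) = cyclic_quotient g"
  proof -
    have "moebius p ` upper_half_plane = upper_half_plane"
    proof (rule antisym)
      show "upper_half_plane \<subseteq> moebius p ` upper_half_plane"
        using inv(2) moebius_upper_half_plane(1) by (metis image_eqI subsetI)
    qed (auto simp: moebius_upper_half_plane)
    then have "cyclic_quotient g = orbit g ` moebius p ` upper_half_plane"
      by (simp add: cyclic_quotient_def)
    then show ?thesis
      by (simp add: cyclic_quotient_def image_image orb cong: image_cong)
  qed
  moreover have "quotient_dist (F A) (F B) = quotient_dist A B"
    if "A \<in> cyclic_quotient (a_elem L)" "B \<in> cyclic_quotient (a_elem L)" for A B
  proof -
    have dists: "{hyp_dist z w |z w. z \<in> C \<and> w \<in> D} = (\<lambda>(z, w). hyp_dist z w) ` (C \<times> D)" for C D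
      by auto
    have "F A \<times> F B = map_prod (moebius p) (moebius p) ` (A \<times> B)"
      by (simp add: F_def map_prod_surj_on)
    then have "(\<lambda>(z, w). hyp_dist z w) ` (F A \<times> F B) =
        (\<lambda>(z, w). hyp_dist (moebius p z) (moebius p w)) ` (A \<times> B)"
      by (simp add: image_image split_def)
    also have "\<dots> = (\<lambda>(z, w). hyp_dist z w) ` (A \<times> B)"
      using sub[OF that(1)] sub[OF that(2)] by (intro image_cong) (auto simp: hyp_dist_moebius subset_iff)
    finally show ?thesis by (simp only: quotient_dist_def dists)
  qed
  ultimately show ?thesis
    unfolding isometric_quotients_def bij_betw_def by blast
qed

lemma isometric_quotients_sym:
  assumes "isometric_quotients g h"
  shows "isometric_quotients h g"
proof -
  obtain F where F: "bij_betw F (cyclic_quotient g) (cyclic_quotient h)"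
    and dist: "\<And>A B. A \<in> cyclic_quotient g \<Longrightarrow> B \<in> cyclic_quotient g \<Longrightarrow> quotient_dist (F A) (F B) = quotient_dist A B"
    using assms unfolding isometric_quotients_def by blast
  define G where "G = inv_into (cyclic_quotient g) F"
  have G: "bij_betw G (cyclic_quotient h) (cyclic_quotient g)"
    unfolding G_def using F by (rule bij_betw_inv_into)
  have "quotient_dist (G A) (G B) = quotient_dist A B"
    if "A \<in> cyclic_quotient h" "B \<in> cyclic_quotient h" for A B
    using dist[of "G A" "G B"] that bij_betwE[OF G] bij_betw_inv_into_right[OF F]
    by (simp add: G_def)
  with G show ?thesis unfolding isometric_quotients_def by blast
qed

lemma isometric_quotients_trans:
  assumes "isometric_quotients g h" "isometric_quotients h k"
  shows "isometric_quotients g k"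
proof -
  obtain F where F: "bij_betw F (cyclic_quotient g) (cyclic_quotient h)"
    and distF: "\<And>A B. A \<in> cyclic_quotient g \<Longrightarrow> B \<in> cyclic_quotient g \<Longrightarrow> quotient_dist (F A) (F B) = quotient_dist A B"
    using assms(1) unfolding isometric_quotients_def by blast
  obtain G where G: "bij_betw G (cyclic_quotient h) (cyclic_quotient k)"
    and distG: "\<And>A B. A \<in> cyclic_quotient h \<Longrightarrow> B \<in> cyclic_quotient h \<Longrightarrow> quotient_dist (G A) (G B) = quotient_dist A B"
    using assms(2) unfolding isometric_quotients_def by blast
  have "bij_betw (G \<circ> F) (cyclic_quotient g) (cyclic_quotient k)"
    using F G by (rule bij_betw_trans)
  moreover have "quotient_dist ((G \<circ> F) A) ((G \<circ> F) B) = quotient_dist A B"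
    if "A \<in> cyclic_quotient g" "B \<in> cyclic_quotient g" for A B
    using that distF distG bij_betwE[OF F] by simp
  ultimately show ?thesis unfolding isometric_quotients_def by blast
qed

text \<open>The distances between points of the quotient that have at least two midpoints. The set is defined by
the metric of the quotient alone, and for the cylinder of length \<open>L\<close> its least element is \<open>L / 2\<close>;
so it recovers the length.\<close>

definition two_midpoint_dists :: "psl2 \<Rightarrow> real set" where
  "two_midpoint_dists g = {quotient_dist A B |A B. A \<in> cyclic_quotient g \<and> B \<in> cyclic_quotient g \<and>
     (\<exists>m \<in> cyclic_quotient g. \<exists>m' \<in> cyclic_quotient g. m \<noteq> m' \<and>
        (\<forall>c \<in> {m, m'}. quotient_dist A c = quotient_dist A B / 2 \<and> quotient_dist c B = quotient_dist A B / 2))}"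

lemma two_midpoint_dists_isometric:
  assumes "isometric_quotients g h"
  shows "two_midpoint_dists g \<subseteq> two_midpoint_dists h"
proof
  obtain F where F: "bij_betw F (cyclic_quotient g) (cyclic_quotient h)"
    and dist: "\<And>A B. A \<in> cyclic_quotient g \<Longrightarrow> B \<in> cyclic_quotient g \<Longrightarrow> quotient_dist (F A) (F B) = quotient_dist A B"
    using assms unfolding isometric_quotients_def by blast
  fix x assume "x \<in> two_midpoint_dists g"
  then obtain A B m m' where *: "x = quotient_dist A B" "A \<in> cyclic_quotient g" "B \<in> cyclic_quotient g"
     "m \<in> cyclic_quotient g" "m' \<in> cyclic_quotient g" "m \<noteq> m'"
     "\<And>c. c \<in> {m, m'} \<Longrightarrow> quotient_dist A c = quotient_dist A B / 2 \<and> quotient_dist c B = quotient_dist A B / 2"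
    unfolding two_midpoint_dists_def by blast
  have "F A \<in> cyclic_quotient h" "F B \<in> cyclic_quotient h" "F m \<in> cyclic_quotient h" "F m' \<in> cyclic_quotient h"
    using bij_betwE[OF F] * by auto
  moreover have "F m \<noteq> F m'"
    using F * by (auto simp: bij_betw_def inj_on_def)
  moreover have "\<forall>c \<in> {F m, F m'}. quotient_dist (F A) c = quotient_dist (F A) (F B) / 2 \<and>
      quotient_dist c (F B) = quotient_dist (F A) (F B) / 2"
    using * dist by auto
  moreover have "x = quotient_dist (F A) (F B)"
    using * dist by simp
  ultimately show "x \<in> two_midpoint_dists h"
    unfolding two_midpoint_dists_def by blast
qed

lemma scale_upper_half_plane:
  "z \<in> upper_half_plane \<Longrightarrow> of_real (exp t) * z \<in> upper_half_plane"
  by (simp add: upper_half_plane_def)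

lemma hyp_dist_scale:
  assumes "z \<in> upper_half_plane" "w \<in> upper_half_plane"
  shows "hyp_dist (of_real (exp t) * z) (of_real (exp u) * w) = hyp_dist z (of_real (exp (u - t)) * w)"
proof -
  have mob: "moebius (a_elem M) z = of_real (exp M) * z" for M z
    using psl2_act_Some_moebius[of "a_elem M" z] by (simp add: a_elem_act)
  have "of_real (exp u) * w = of_real (exp t) * (of_real (exp (u - t)) * w)"
    by (simp flip: mult.assoc of_real_mult exp_add)
  then show ?thesis
    using hyp_dist_moebius[OF assms(1) scale_upper_half_plane[OF assms(2), of "u - t"], of "a_elem t"]
    by (simp only: mob)
qed

text \<open>As a function of \<open>t\<close> the distance from \<open>z\<close> to \<open>e\<^sup>t w\<close> depends only on \<open>\<bar>t + ln (\<bar>w\<bar> / \<bar>z\<bar>)\<bar>\<close>, increasingly;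
so the nearest points of an orbit are those whose logarithmic modulus is nearest.\<close>

lemma cosh_hyp_dist_scale:
  assumes "z \<in> upper_half_plane" "w \<in> upper_half_plane"
  shows "cosh (hyp_dist z (of_real (exp t) * w)) =
    (cmod z * cmod w * cosh (t + ln (cmod w / cmod z)) - Re z * Re w) / (Im z * Im w)"
proof -
  have "z \<noteq> 0" "w \<noteq> 0" using assms by (auto simp: upper_half_plane_def)
  then have r: "cmod z > 0" "cmod w > 0" by auto
  define \<tau> where "\<tau> = ln (cmod w / cmod z)"
  have e: "exp \<tau> = cmod w / cmod z" "exp (- \<tau>) = cmod z / cmod w"
    using r by (simp_all add: \<tau>_def exp_minus)
  have "cmod z * cmod w * (2 * cosh (t + \<tau>)) = cmod z * cmod w * (exp t * exp \<tau> + exp (- t) * exp (- \<tau>))"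
    by (simp add: cosh_field_def flip: exp_add)
  also have "\<dots> = exp (- t) * (cmod z)\<^sup>2 + exp t * (cmod w)\<^sup>2"
    unfolding e using r by (simp add: field_simps power2_eq_square)
  finally have *: "cmod z * cmod w * (2 * cosh (t + \<tau>)) = exp (- t) * (cmod z)\<^sup>2 + exp t * (cmod w)\<^sup>2" .
  have "cosh (hyp_dist z (of_real (exp t) * w)) =
     ((cmod z)\<^sup>2 + (exp t)\<^sup>2 * (cmod w)\<^sup>2 - 2 * Re z * (exp t * Re w)) / (2 * Im z * (exp t * Im w))"
    unfolding cosh_hyp_dist[OF assms(1) scale_upper_half_plane[OF assms(2)]]
    by (simp add: norm_mult power_mult_distrib)
  also have "(cmod z)\<^sup>2 + (exp t)\<^sup>2 * (cmod w)\<^sup>2 - 2 * Re z * (exp t * Re w) =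
     exp t * (exp (- t) * (cmod z)\<^sup>2 + exp t * (cmod w)\<^sup>2 - 2 * Re z * Re w)"
    by (simp add: algebra_simps power2_eq_square exp_minus)
  also have "\<dots> / (2 * Im z * (exp t * Im w)) =
      (2 * exp t) * (cmod z * cmod w * cosh (t + \<tau>) - Re z * Re w) / ((2 * exp t) * (Im z * Im w))"
    unfolding *[symmetric] by (simp add: algebra_simps)
  also have "\<dots> = (cmod z * cmod w * cosh (t + \<tau>) - Re z * Re w) / (Im z * Im w)"
    by (rule mult_divide_mult_cancel_left) simp
  finally show ?thesis by (simp add: \<tau>_def)
qed

lemma hyp_dist_scale_le_iff:
  assumes "z \<in> upper_half_plane" "w \<in> upper_half_plane"
  shows "hyp_dist z (of_real (exp t) * w) \<le> hyp_dist z (of_real (exp u) * w) \<longleftrightarrow>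
    \<bar>t + ln (cmod w / cmod z)\<bar> \<le> \<bar>u + ln (cmod w / cmod z)\<bar>"
proof -
  have "z \<noteq> 0" "w \<noteq> 0" using assms by (auto simp: upper_half_plane_def)
  then have r: "cmod z * cmod w > 0" by simp
  have im: "Im z * Im w > 0" using assms by (auto simp: upper_half_plane_def)
  \<comment> \<open>The hyperbolic cosine of the distance is an increasing affine function of \<open>cosh (t + \<tau>)\<close>.\<close>
  have aux: "(R * A - \<gamma>) / K \<le> (R * B - \<gamma>) / K \<longleftrightarrow> A \<le> B" if "0 < K" "0 < R" for K R A B \<gamma> :: real
    using that by (simp add: divide_le_cancel)
  have "hyp_dist z (of_real (exp t) * w) \<le> hyp_dist z (of_real (exp u) * w) \<longleftrightarrow>
     cosh (hyp_dist z (of_real (exp t) * w)) \<le> cosh (hyp_dist z (of_real (exp u) * w))"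
    using assms by (simp add: cosh_real_nonneg_le_iff hyp_dist_nonneg scale_upper_half_plane)
  also have "\<dots> \<longleftrightarrow> cosh (t + ln (cmod w / cmod z)) \<le> cosh (u + ln (cmod w / cmod z))"
    unfolding cosh_hyp_dist_scale[OF assms] by (rule aux[OF im r])
  also have "\<dots> \<longleftrightarrow> \<bar>t + ln (cmod w / cmod z)\<bar> \<le> \<bar>u + ln (cmod w / cmod z)\<bar>"
    by (metis abs_ge_zero cosh_real_abs cosh_real_nonneg_le_iff)
  finally show ?thesis .
qed

text \<open>Scaling both points is an isometry, so in the infimum over pairs of orbit points the first point
may be kept fixed.\<close>

lemma cylinder_dist_eqI:
  assumes "z \<in> upper_half_plane" "w \<in> upper_half_plane"
    and "\<And>j :: int. hyp_dist z w \<le> hyp_dist z (of_real (exp (of_int j * L)) * w)"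
  shows "quotient_dist (orbit (a_elem L) z) (orbit (a_elem L) w) = hyp_dist z w"
  unfolding quotient_dist_def
proof (rule cInf_eq_minimum)
  have "z = of_real (exp (of_int 0 * L)) * z" "w = of_real (exp (of_int 0 * L)) * w" by simp_all
  then show "hyp_dist z w \<in> {hyp_dist x y |x y. x \<in> orbit (a_elem L) z \<and> y \<in> orbit (a_elem L) w}"
    unfolding orbit_a_elem by blast
  fix d assume "d \<in> {hyp_dist x y |x y. x \<in> orbit (a_elem L) z \<and> y \<in> orbit (a_elem L) w}"
  then obtain j k :: int where "d = hyp_dist (of_real (exp (of_int j * L)) * z) (of_real (exp (of_int k * L)) * w)"
    unfolding orbit_a_elem by blast
  then have "d = hyp_dist z (of_real (exp (of_int (k - j) * L)) * w)"
    using hyp_dist_scale[OF assms(1,2)] by (simp add: left_diff_distrib)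
  then show "hyp_dist z w \<le> d" using assms(3)[of "k - j"] by simp
qed

lemma orbit_a_elem_scale: "orbit (a_elem L) (of_real (exp (of_int k * L)) * z) = orbit (a_elem L) z"
proof -
  have "range (\<lambda>j :: int. f (j + k)) = range f" for f :: "int \<Rightarrow> complex"
  proof -
    have "range (\<lambda>j :: int. j + k) = UNIV"
      by (rule surjI[of _ "\<lambda>j. j - k"]) simp
    then show ?thesis
      by (metis image_image)
  qed
  from this[of "\<lambda>j. of_real (exp (of_int j * L)) * z"] show ?thesis
    by (simp add: orbit_a_elem distrib_right exp_add mult.assoc)
qed

lemma cylinder_dist_attained:
  assumes "z \<in> upper_half_plane" "w \<in> upper_half_plane" "L > 0"
  obtains w' where "w' \<in> upper_half_plane" "orbit (a_elem L) w' = orbit (a_elem L) w"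
    "quotient_dist (orbit (a_elem L) z) (orbit (a_elem L) w) = hyp_dist z w'"
proof -
  define \<tau> where "\<tau> = ln (cmod w / cmod z)"
  \<comment> \<open>The integer \<open>k\<close> that minimizes \<open>\<bar>k L + \<tau>\<bar>\<close>.\<close>
  define k where "k = round (- \<tau> / L)"
  have min: "\<bar>of_int k * L + \<tau>\<bar> \<le> \<bar>of_int j * L + \<tau>\<bar>" for j :: int
  proof -
    have "\<bar>of_int i * L + \<tau>\<bar> = L * \<bar>- \<tau> / L - of_int i\<bar>" for i :: int
    proof -
      have "\<bar>of_int i * L + \<tau>\<bar> = \<bar>L * (- (- \<tau> / L - of_int i))\<bar>"
        using \<open>L > 0\<close> by (simp add: algebra_simps)
      also have "\<dots> = L * \<bar>- \<tau> / L - of_int i\<bar>"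
        unfolding abs_mult abs_minus using \<open>L > 0\<close> by simp
      finally show ?thesis .
    qed
    then show ?thesis
      using round_diff_minimal[of "- \<tau> / L" j] \<open>L > 0\<close> by (simp add: k_def)
  qed
  define w' where "w' = of_real (exp (of_int k * L)) * w"
  have w': "w' \<in> upper_half_plane" "orbit (a_elem L) w' = orbit (a_elem L) w"
    using assms scale_upper_half_plane by (simp_all only: w'_def orbit_a_elem_scale)
  have "quotient_dist (orbit (a_elem L) z) (orbit (a_elem L) w') = hyp_dist z w'"
  proof (rule cylinder_dist_eqI[OF assms(1) w'(1)])
    fix j :: int
    have "of_real (exp (of_int j * L)) * w' = of_real (exp (of_int (j + k) * L)) * w"
      by (simp add: w'_def exp_add distrib_right mult.assoc)
    then show "hyp_dist z w' \<le> hyp_dist z (of_real (exp (of_int j * L)) * w')"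
      unfolding w'_def using hyp_dist_scale_le_iff[OF assms(1,2)] min[of "j + k"] by (simp only: \<tau>_def)
  qed
  then show ?thesis using that w' by simp
qed

lemma cylinder_dist_le:
  assumes "z \<in> upper_half_plane" "w \<in> upper_half_plane"
  shows "quotient_dist (orbit (a_elem L) z) (orbit (a_elem L) w) \<le> hyp_dist z w"
  unfolding quotient_dist_def
proof (rule cInf_lower)
  have "z = of_real (exp (of_int 0 * L)) * z" "w = of_real (exp (of_int 0 * L)) * w" by simp_all
  then show "hyp_dist z w \<in> {hyp_dist x y |x y. x \<in> orbit (a_elem L) z \<and> y \<in> orbit (a_elem L) w}"
    unfolding orbit_a_elem by blast
  have "hyp_dist x y \<ge> 0" if "x \<in> orbit (a_elem L) z" "y \<in> orbit (a_elem L) w" for x y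
    using that assms by (intro hyp_dist_nonneg) (auto simp: orbit_a_elem scale_upper_half_plane)
  then show "bdd_below {hyp_dist x y |x y. x \<in> orbit (a_elem L) z \<and> y \<in> orbit (a_elem L) w}"
    by (intro bdd_belowI[of _ 0]) auto
qed

text \<open>On the central geodesic, a closed curve of length \<open>L\<close>, the orbits of \<open>i\<close> and \<open>e\<^sup>L\<^sup>/\<^sup>2 i\<close> are
antipodal; the orbits of \<open>e\<^sup>L\<^sup>/\<^sup>4 i\<close> and \<open>e\<^sup>-\<^sup>L\<^sup>/\<^sup>4 i\<close> are midpoints on the two sides.\<close>

lemma half_length_in_two_midpoint_dists:
  assumes "L > 0"
  shows "L / 2 \<in> two_midpoint_dists (a_elem L)"
proof -
  define P where "P = (\<lambda>t. complex_of_real (exp t) * \<i>)"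
  have P: "P t \<in> upper_half_plane" for t
    by (simp add: P_def upper_half_plane_def)
  have i: "\<i> \<in> upper_half_plane" by (simp add: upper_half_plane_def)
  have dP: "hyp_dist (P t) (P u) = \<bar>u - t\<bar>" for t u
  proof -
    have "cosh (hyp_dist (P t) (P u)) = cosh \<bar>u - t\<bar>"
      unfolding P_def hyp_dist_scale[OF i i] cosh_hyp_dist_scale[OF i i] by simp
    then show ?thesis
      using hyp_dist_nonneg[OF P P] by (metis abs_ge_zero antisym cosh_real_nonneg_le_iff order_refl)
  qed
  have PL: "of_real (exp (of_int j * L)) * P t = P (t + of_int j * L)" for j :: int and t
    by (simp add: P_def exp_add mult_ac)
  define Q where "Q = (\<lambda>t. orbit (a_elem L) (P t))"
  have Q: "Q t \<in> cyclic_quotient (a_elem L)" for t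
    using P by (simp add: Q_def cyclic_quotient_def)
  have dO: "quotient_dist (Q t) (Q u) = \<bar>u - t\<bar>" if "\<bar>u - t\<bar> \<le> L / 2" for t u
  proof -
    have "quotient_dist (Q t) (Q u) = hyp_dist (P t) (P u)"
      unfolding Q_def
    proof (rule cylinder_dist_eqI[OF P P])
      fix j :: int
      have "\<bar>u - t\<bar> \<le> \<bar>u + of_int j * L - t\<bar>"
      proof (cases "j = 0")
        case False
        then have "1 * L \<le> of_int \<bar>j\<bar> * L"
          using assms by (intro mult_right_mono) linarith+
        then have "L \<le> \<bar>of_int j * L\<bar>"
          using assms by (simp add: abs_mult)
        then show ?thesis using that by linarith
      qed simp
      then show "hyp_dist (P t) (P u) \<le> hyp_dist (P t) (of_real (exp (of_int j * L)) * P u)"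
        by (simp only: PL dP)
    qed
    then show ?thesis by (simp add: dP)
  qed
  \<comment> \<open>The antipodal orbit is also reached in the other direction.\<close>
  have per: "Q (- L / 2) = Q (L / 2)"
    using orbit_a_elem_scale[of L 1 "P (- L / 2)"] PL[of 1 "- L / 2"] by (simp add: Q_def)
  have "Q (L / 4) \<noteq> Q (- L / 4)"
  proof
    assume "Q (L / 4) = Q (- L / 4)"
    then have "quotient_dist (Q (L / 4)) (Q (L / 4)) = quotient_dist (Q (L / 4)) (Q (- L / 4))" by simp
    then show False using dO[of "L / 4" "L / 4"] dO[of "- L / 4" "L / 4"] assms by simp
  qed
  moreover have "\<forall>c \<in> {Q (L / 4), Q (- L / 4)}. quotient_dist (Q 0) c = quotient_dist (Q 0) (Q (L / 2)) / 2 \<and>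
       quotient_dist c (Q (L / 2)) = quotient_dist (Q 0) (Q (L / 2)) / 2"
    using dO[of "L / 4" 0] dO[of "- L / 4" 0] dO[of "L / 2" 0] dO[of "L / 2" "L / 4"] dO[of "- L / 2" "- L / 4"] assms
    using per by (auto simp: abs_if)
  moreover have "quotient_dist (Q 0) (Q (L / 2)) = L / 2"
    using dO[of "L / 2" 0] assms by simp
  ultimately show ?thesis
    unfolding two_midpoint_dists_def using Q
    by (intro CollectI exI[of _ "Q 0"] exI[of _ "Q (L / 2)"] conjI
      bexI[of _ "Q (L / 4)"] bexI[of _ "Q (- L / 4)"]) auto
qed

text \<open>Lift \<open>A\<close> to a point \<open>x\<close> and follow shortest segments through the two midpoints to lifts \<open>y\<close>, \<open>y'\<close> of
\<open>B\<close>. Midpoints in the plane are unique, so \<open>y \<noteq> y' = e\<^sup>k\<^sup>L y\<close>, yet both have distance \<open>d\<close>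
from \<open>x\<close>. Hence the logarithmic moduli of \<open>x\<close> and \<open>y\<close> differ by \<open>\<bar>k\<bar> L / 2 \<ge> L / 2\<close>, and the
distance of two points is at least the difference of their logarithmic moduli.\<close>

lemma two_midpoint_dists_ge:
  assumes "L > 0" and "d \<in> two_midpoint_dists (a_elem L)"
  shows "d \<ge> L / 2"
proof -
  define orb where "orb = orbit (a_elem L)"
  obtain A B m m' where d: "d = quotient_dist A B" and
     in_quot: "A \<in> cyclic_quotient (a_elem L)" "B \<in> cyclic_quotient (a_elem L)"
       "m \<in> cyclic_quotient (a_elem L)" "m' \<in> cyclic_quotient (a_elem L)" and "m \<noteq> m'"
     and mid: "\<And>c. c \<in> {m, m'} \<Longrightarrow> quotient_dist A c = d / 2 \<and> quotient_dist c B = d / 2"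
    using assms(2) unfolding two_midpoint_dists_def by blast
  define a where "a = d / 2"
  obtain x where x: "x \<in> upper_half_plane" "A = orb x"
    using in_quot(1) by (auto simp: cyclic_quotient_def orb_def)
  have lift: "\<exists>z y. z \<in> upper_half_plane \<and> y \<in> upper_half_plane \<and> orb z = c \<and> orb y = B \<and>
      hyp_dist x z = a \<and> hyp_dist z y = a \<and> hyp_dist x y \<ge> 2 * a" if c: "c \<in> {m, m'}" for c
  proof -
    obtain z0 y0 where zy0: "z0 \<in> upper_half_plane" "c = orb z0" "y0 \<in> upper_half_plane" "B = orb y0"
      using in_quot c by (auto simp: cyclic_quotient_def orb_def)
    obtain z where z: "z \<in> upper_half_plane" "orb z = c" "quotient_dist A c = hyp_dist x z"
      using cylinder_dist_attained[OF x(1) zy0(1) assms(1)] zy0 x(2) by (metis orb_def)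
    obtain y where y: "y \<in> upper_half_plane" "orb y = B" "quotient_dist c B = hyp_dist z y"
      using cylinder_dist_attained[OF z(1) zy0(3) assms(1)] zy0 z(2) by (metis orb_def)
    have "hyp_dist x y \<ge> d"
      using cylinder_dist_le[OF x(1) y(1), of L] x(2) y(2) by (simp add: d orb_def)
    with z y mid[OF c] show ?thesis
      by (intro exI[of _ z] exI[of _ y]) (simp add: a_def)
  qed
  obtain z y where zy: "z \<in> upper_half_plane" "y \<in> upper_half_plane" "orb z = m" "orb y = B"
      "hyp_dist x z = a" "hyp_dist z y = a" "hyp_dist x y \<ge> 2 * a"
    using lift[of m] by auto
  obtain z' y' where zy': "z' \<in> upper_half_plane" "y' \<in> upper_half_plane" "orb z' = m'" "orb y' = B"
      "hyp_dist x z' = a" "hyp_dist z' y' = a" "hyp_dist x y' \<ge> 2 * a"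
    using lift[of m'] by auto
  have "y \<noteq> y'"
    using hyperbolic_midpoint_unique[OF x(1) zy(2,1) zy'(1) zy(5,6) zy'(5)] zy zy' \<open>m \<noteq> m'\<close> by auto
  have xy: "hyp_dist x y = 2 * a" and xy': "hyp_dist x y' = 2 * a"
    using hyperbolic_midpoint(1)[OF x(1) zy(2,1,5,6,7)] hyperbolic_midpoint(1)[OF x(1) zy'(2,1,5,6,7)] by auto
  have "y' \<in> orb y'"
    using rangeI[of "\<lambda>k :: int. of_real (exp (of_int k * L)) * y'" 0] by (simp add: orb_def orbit_a_elem)
  then have "y' \<in> orb y" using zy zy' by simp
  then obtain k :: int where k: "y' = of_real (exp (of_int k * L)) * y"
    by (auto simp: orb_def orbit_a_elem)
  have "k \<noteq> 0" using k \<open>y \<noteq> y'\<close> by auto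
  define \<tau> where "\<tau> = ln (cmod y / cmod x)"
  have "\<bar>0 + \<tau>\<bar> = \<bar>of_int k * L + \<tau>\<bar>"
    using hyp_dist_scale_le_iff[OF x(1) zy(2), of 0 "of_int k * L"]
      hyp_dist_scale_le_iff[OF x(1) zy(2), of "of_int k * L" 0] xy xy' k
    by (simp add: \<tau>_def)
  \<comment> \<open>Two different numbers with equal modulus are opposite.\<close>
  then have "\<tau> = - (of_int k * L) / 2"
    using \<open>k \<noteq> 0\<close> assms(1) by (auto simp: abs_if split: if_splits)
  then have "\<bar>\<tau>\<bar> = of_int \<bar>k\<bar> * L / 2"
    using assms(1) by (simp add: abs_mult)
  moreover have "1 * L \<le> of_int \<bar>k\<bar> * L"
    using assms(1) \<open>k \<noteq> 0\<close> by (intro mult_right_mono) linarith+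
  ultimately have \<tau>: "L / 2 \<le> \<bar>\<tau>\<bar>" by simp
  have im: "Im x > 0" "Im y > 0"
    using x zy by (auto simp: upper_half_plane_def)
  \<comment> \<open>The Cauchy--Schwarz inequality, which bounds the distance below by \<open>\<bar>\<tau>\<bar>\<close>.\<close>
  have CS: "Re x * Re y + Im x * Im y \<le> cmod x * cmod y"
    using complex_Re_le_cmod[of "x * cnj y"] by (simp add: norm_mult)
  have "cosh \<bar>\<tau>\<bar> \<le> cosh (2 * a)"
  proof -
    have "Im x * Im y \<le> cmod x * cmod y"
      using im abs_Im_le_cmod[of x] abs_Im_le_cmod[of y] by (intro mult_mono) auto
    then have "(Im x * Im y) * (cosh \<tau> - 1) \<le> (cmod x * cmod y) * (cosh \<tau> - 1)"
      by (intro mult_right_mono) (auto simp: cosh_real_ge_1)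
    then have "Im x * Im y * cosh \<tau> \<le> cmod x * cmod y * cosh \<tau> - Re x * Re y"
      using CS by (simp add: algebra_simps)
    then have "cosh \<tau> \<le> (cmod x * cmod y * cosh \<tau> - Re x * Re y) / (Im x * Im y)"
      using im by (simp add: pos_le_divide_eq mult_ac)
    also have "\<dots> = cosh (hyp_dist x y)"
      using cosh_hyp_dist_scale[OF x(1) zy(2), of 0] by (simp add: \<tau>_def)
    finally show ?thesis using xy by simp
  qed
  moreover have "2 * a \<ge> 0"
    using xy hyp_dist_nonneg[OF x(1) zy(2)] by simp
  ultimately have "\<bar>\<tau>\<bar> \<le> 2 * a"
    by (subst (asm) cosh_real_nonneg_le_iff) auto
  then show ?thesis using \<tau> by (simp add: a_def)
qed

theorem cylinder_length_unique:
  assumes "L > 0" "l > 0" and g: "g = p * a_elem L * inverse p" and iso: "isometric_quotients g (a_elem l)"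
  shows "L = l"
proof (rule antisym)
  have iso': "isometric_quotients (a_elem L) (a_elem l)"
    using isometric_quotients_trans[OF isometric_quotients_conj[OF g] iso] .
  show "l \<le> L"
    using two_midpoint_dists_ge[OF \<open>l > 0\<close>] two_midpoint_dists_isometric[OF iso']
      half_length_in_two_midpoint_dists[OF \<open>L > 0\<close>] by force
  show "L \<le> l"
    using two_midpoint_dists_ge[OF \<open>L > 0\<close>] two_midpoint_dists_isometric[OF isometric_quotients_sym[OF iso']]
      half_length_in_two_midpoint_dists[OF \<open>l > 0\<close>] by force
qed

section \<open>Holomorphic functions homogeneous under a contraction\<close>

text \<open>The \<open>k\<close>-th derivative at \<open>0\<close> of the functional equation reads \<open>t\<^sup>k P\<^sup>(\<^sup>k\<^sup>)(0) = \<mu> P\<^sup>(\<^sup>k\<^sup>)(0)\<close>.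
The powers of \<open>t\<close> are distinct, so exactly one Taylor coefficient of \<open>P\<close> is nonzero.\<close>

lemma scaling_eigenfunction_monomial:
  fixes P :: "complex \<Rightarrow> complex" and t :: real
  assumes U: "open U" "connected U" "0 \<in> U" and t: "0 < t" "t < 1"
    and scale: "\<And>w. w \<in> U \<Longrightarrow> of_real t * w \<in> U"
    and P: "P holomorphic_on U" and eq: "\<And>w. w \<in> U \<Longrightarrow> P (of_real t * w) = \<mu> * P w"
    and nz: "w0 \<in> U" "P w0 \<noteq> 0"
  obtains n c where "\<mu> = of_real t ^ n" "\<And>w. w \<in> U \<Longrightarrow> P w = c * w ^ n"
proof -
  have deriv_eq: "of_real t ^ k * (deriv ^^ k) P 0 = \<mu> * (deriv ^^ k) P 0" for k
  proof -
    have "(deriv ^^ k) (\<lambda>w. P (of_real t * w)) 0 = (deriv ^^ k) (\<lambda>w. \<mu> * P w) 0"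
      by (rule higher_deriv_transform_within_open[OF _ _ U(1,3)])
        (use P scale eq U in \<open>auto intro!: holomorphic_intros holomorphic_on_compose_gen[OF _ P, unfolded o_def]\<close>)
    moreover have "(deriv ^^ k) (\<lambda>w. P (of_real t * w)) 0 = of_real t ^ k * (deriv ^^ k) P (of_real t * 0)"
      using higher_deriv_compose_linear[OF P U(1) U(1) U(3) scale] .
    moreover have "(deriv ^^ k) (\<lambda>w. \<mu> * P w) 0 = \<mu> * (deriv ^^ k) P 0"
      using higher_deriv_cmult[OF P U(3) U(1)] by simp
    ultimately show ?thesis by simp
  qed
  obtain n where n: "(deriv ^^ n) P 0 \<noteq> 0"
    using holomorphic_fun_eq_0_on_connected[OF P U(1,2) _ U(3) nz(1)] nz(2) by blast
  then have \<mu>: "\<mu> = of_real t ^ n"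
    using deriv_eq[of n] by simp
  have vanish: "(deriv ^^ k) P 0 = 0" if "k \<noteq> n" for k
  proof (rule ccontr)
    assume "(deriv ^^ k) P 0 \<noteq> 0"
    then have "complex_of_real (t ^ k) = of_real (t ^ n)"
      using deriv_eq[of k] \<mu> by simp
    then have "t ^ k = t ^ n"
      by (simp only: of_real_eq_iff)
    then show False
      using power_inject_exp'[of t k n] t that by simp
  qed
  \<comment> \<open>The power series of \<open>P\<close> at \<open>0\<close> reduces to its term of degree \<open>n\<close>.\<close>
  define c where "c = (deriv ^^ n) P 0 / fact n"
  obtain e where e: "e > 0" "ball 0 e \<subseteq> U"
    using U open_contains_ball by blast
  have near: "P w = c * w ^ n" if "w \<in> ball 0 e" for w
  proof -
    have "(\<lambda>k. (deriv ^^ k) P 0 / fact k * (w - 0) ^ k) sums P w"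
      using holomorphic_power_series[OF holomorphic_on_subset[OF P e(2)] that] .
    moreover have "(\<lambda>k. (deriv ^^ k) P 0 / fact k * (w - 0) ^ k) = (\<lambda>k. if k = n then c * w ^ k else 0)"
      by (auto simp: c_def vanish)
    ultimately show ?thesis
      using sums_single[of n "\<lambda>k. c * w ^ k"] sums_unique2 by metis
  qed
  have "P w = c * w ^ n" if "w \<in> U" for w
    by (rule analytic_continuation_open[of "ball 0 e" U P "\<lambda>w. c * w ^ n"])
      (use e U P near that in \<open>auto intro!: holomorphic_intros\<close>)
  with \<mu> show ?thesis using that by blast
qed

section \<open>Complex powers of the derivative\<close>

definition regular_on :: "psl2 \<Rightarrow> complex set \<Rightarrow> bool" where
  "regular_on g X \<longleftrightarrow> (\<forall>z \<in> X. psl2_act g (Some z) \<noteq> None)"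

lemma regular_on_psl2_mat:
  assumes "a * d - b * c = 1"
  shows "regular_on (psl2_mat a b c d) X \<longleftrightarrow> (\<forall>z \<in> X. of_real c * z + of_real d \<noteq> (0 :: complex))"
  by (auto simp: regular_on_def psl2_act_psl2_mat[OF assms])

lemma regular_on_act:
  assumes "regular_on g X" "z \<in> X"
  shows "psl2_act g (Some z) = Some (moebius g z)"
  using assms psl2_act_Some_moebius by (auto simp: regular_on_def)

lemma moebius_mult:
  assumes "regular_on h X" "regular_on (g * h) X" "z \<in> X"
  shows "moebius (g * h) z = moebius g (moebius h z)" "psl2_act g (Some (moebius h z)) \<noteq> None"
proof -
  have "psl2_act g (Some (moebius h z)) = Some (moebius (g * h) z)"
    using psl2_act_mult[of g h "Some z"] regular_on_act[OF assms(1,3)] regular_on_act[OF assms(2,3)] by simp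
  then show "moebius (g * h) z = moebius g (moebius h z)" "psl2_act g (Some (moebius h z)) \<noteq> None"
    using psl2_act_Some_moebius[of g "moebius h z"] by auto
qed

lemma regular_on_has_field_derivative:
  assumes "regular_on g X" "z \<in> X"
  shows "(moebius g has_field_derivative deriv (moebius g) z) (at z)" "deriv (moebius g) z \<noteq> 0"
proof -
  obtain a b c d where g: "g = psl2_mat a b c d" and det: "a * d - b * c = 1" by (rule psl2_cases)
  have M: "of_real c * z + of_real d \<noteq> (0 :: complex)"
    using assms by (simp add: g regular_on_psl2_mat[OF det])
  have "moebius g = (\<lambda>z. (of_real a * z + of_real b) / (of_real c * z + of_real d))"
    by (simp add: fun_eq_iff g moebius_psl2_mat[OF det])
  then have "moebius g field_differentiable at z"
    using M by (auto intro!: derivative_intros)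
  then show "(moebius g has_field_derivative deriv (moebius g) z) (at z)"
    by (simp add: field_differentiable_derivI)
  show "deriv (moebius g) z \<noteq> 0"
    using M by (simp add: g deriv_moebius_psl2_mat[OF det])
qed

lemma regular_on_holomorphic:
  assumes "regular_on g X"
  shows "moebius g holomorphic_on X"
  using regular_on_has_field_derivative(1)[OF assms]
  by (auto simp: holomorphic_on_def field_differentiable_def intro: DERIV_subset)

lemma regular_on_deriv_powr_holomorphic:
  assumes "regular_on g (ball (of_real c) r)"
  shows "(\<lambda>z. deriv (moebius g) z powr s) holomorphic_on ball (of_real c) r"
proof -
  obtain a b c' d where g: "g = psl2_mat a b c' d" and det: "a * d - b * c' = 1" by (rule psl2_cases)
  show ?thesis
    unfolding g using assms by (intro deriv_moebius_powr_branch(1)[OF det]) (simp add: g regular_on_psl2_mat[OF det])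
qed

lemma regular_on_real:
  assumes "regular_on g X" "of_real x \<in> X"
  obtains y u where "moebius g (of_real x) = of_real y" "deriv (moebius g) (of_real x) = of_real u" "u > 0"
proof -
  obtain a b c d where g: "g = psl2_mat a b c d" and det: "a * d - b * c = 1" by (rule psl2_cases)
  have M: "of_real c * of_real x + of_real d \<noteq> (0 :: complex)"
    using assms by (simp add: g regular_on_psl2_mat[OF det])
  then have "c * x + d \<noteq> 0"
    by (metis of_real_0 of_real_add of_real_mult)
  then have "1 / (c * x + d)\<^sup>2 > 0" by simp
  moreover have "moebius g (of_real x) = of_real ((a * x + b) / (c * x + d))"
    by (simp add: g moebius_psl2_mat[OF det])
  moreover have "deriv (moebius g) (of_real x) = of_real (1 / (c * x + d)\<^sup>2)"
    using deriv_moebius_psl2_mat[OF det M] by (simp add: g)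
  ultimately show ?thesis by (rule that[rotated 2])
qed

lemma deriv_moebius_mult:
  assumes "regular_on h X" "regular_on (g * h) X" "z \<in> X" and X: "open X"
  shows "deriv (moebius (g * h)) z = deriv (moebius g) (moebius h z) * deriv (moebius h) z"
proof -
  have "regular_on g {moebius h z}"
    using moebius_mult(2)[OF assms(1-3)] by (simp add: regular_on_def)
  then have "(moebius g has_field_derivative deriv (moebius g) (moebius h z)) (at (moebius h z))"
    by (rule regular_on_has_field_derivative) simp
  then have "((\<lambda>z. moebius g (moebius h z)) has_field_derivative
      deriv (moebius g) (moebius h z) * deriv (moebius h) z) (at z)"
    using regular_on_has_field_derivative(1)[OF assms(1,3)] by (rule DERIV_chain2)
  then have "(moebius (g * h) has_field_derivative
      deriv (moebius g) (moebius h z) * deriv (moebius h) z) (at z)"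
    by (rule has_field_derivative_transform_within_open[OF _ X assms(3)])
      (simp add: moebius_mult(1)[OF assms(1,2)])
  then show ?thesis by (rule DERIV_imp_deriv)
qed

text \<open>The principal power is not multiplicative for complex arguments. At real points, however, all three
derivatives are positive and the chain rule gives the equation; both sides are holomorphic on the
disk, so the identity theorem extends it from the real diameter.\<close>

lemma deriv_powr_cocycle:
  assumes h: "regular_on h (ball (of_real c) r)" and gh: "regular_on (g * h) (ball (of_real c) r)"
    and g: "regular_on g (ball (of_real c') r')"
    and map: "\<And>z. z \<in> ball (of_real c) r \<Longrightarrow> moebius h z \<in> ball (of_real c') r'"
    and z: "z \<in> ball (of_real c) r"
  shows "deriv (moebius (g * h)) z powr s =
     deriv (moebius g) (moebius h z) powr s * deriv (moebius h) z powr s"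
proof -
  define B where "B = ball (complex_of_real c) r"
  define f where "f = (\<lambda>z. deriv (moebius (g * h)) z powr s -
     deriv (moebius g) (moebius h z) powr s * deriv (moebius h) z powr s)"
  have "r > 0" using z by (metis ball_eq_empty empty_iff not_le)
  define R where "R = {z \<in> B. z \<in> \<real>}"
  have hol: "f holomorphic_on B"
    unfolding f_def B_def
    by (intro holomorphic_intros regular_on_deriv_powr_holomorphic gh h
      holomorphic_on_compose_gen[OF regular_on_holomorphic[OF h] regular_on_deriv_powr_holomorphic[OF g], unfolded o_def])
      (use map in auto)
  \<comment> \<open>Real points: all factors are positive real numbers.\<close>
  have zero: "f x = 0" if x: "x \<in> R" for x
  proof -
    obtain t where t: "x = of_real t" "of_real t \<in> B"
      using x by (auto simp: R_def elim: Reals_cases)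
    obtain y u where h': "moebius h x = of_real y" "deriv (moebius h) x = of_real u" "u > 0"
      using regular_on_real[OF h, of t] t by (metis B_def)
    have "of_real y \<in> ball (complex_of_real c') r'"
      using map t h'(1) by (metis B_def)
    then obtain v where v: "deriv (moebius g) (moebius h x) = of_real v" "v > 0"
      using regular_on_real[OF g, of y] h'(1) by metis
    have "deriv (moebius (g * h)) x = of_real v * of_real u"
      using deriv_moebius_mult[OF h gh] t h' v by (simp add: B_def)
    then show ?thesis
      using h' v by (simp add: f_def powr_times_real)
  qed
  have lim: "of_real c islimpt R"
    unfolding islimpt_approachable
  proof (intro allI impI)
    fix e :: real assume "e > 0"
    define t where "t = min e r / 2"
    have t: "0 < t" "t < e" "t < r" using \<open>e > 0\<close> \<open>r > 0\<close> by (auto simp: t_def)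
    have "complex_of_real (c + t) \<in> R" "complex_of_real (c + t) \<noteq> of_real c" "dist (complex_of_real (c + t)) (of_real c) < e"
      using t by (auto simp: R_def B_def dist_norm)
    then show "\<exists>x'\<in>R. x' \<noteq> complex_of_real c \<and> dist x' (complex_of_real c) < e" by blast
  qed
  have "open B" "connected B" "R \<subseteq> B" "of_real c \<in> B" "z \<in> B"
    using z \<open>r > 0\<close> by (auto simp: B_def R_def)
  then have "f z = 0"
    using analytic_continuation[OF hol _ _ _ _ lim zero] by blast
  then show ?thesis by (simp add: f_def)
qed

lemma powr_of_real_pos_mult:
  assumes "x > 0" "w \<noteq> (0 :: complex)"
  shows "(of_real x * w) powr s = exp (s * of_real (ln x)) * w powr s"
  using assms by (simp add: powr_def Ln_times_of_real Ln_of_real distrib_left exp_add)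

lemma norm_powr_bounded:
  assumes "0 < m" "m \<le> cmod w" "cmod w \<le> M"
  shows "norm (w powr s) \<le> exp (norm s * (\<bar>ln m\<bar> + \<bar>ln M\<bar> + pi))"
proof -
  have "w \<noteq> 0" using assms by auto
  have "norm (Ln w) \<le> \<bar>Re (Ln w)\<bar> + \<bar>Im (Ln w)\<bar>"
    by (rule cmod_le)
  also have "Re (Ln w) = ln (norm w)"
    using \<open>w \<noteq> 0\<close> by simp
  also have "\<bar>Im (Ln w)\<bar> \<le> pi"
    using mpi_less_Im_Ln[OF \<open>w \<noteq> 0\<close>] Im_Ln_le_pi[OF \<open>w \<noteq> 0\<close>] by linarith
  also have "\<bar>ln (norm w)\<bar> \<le> \<bar>ln m\<bar> + \<bar>ln M\<bar>"
  proof -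
    have "ln m \<le> ln (norm w)" "ln (norm w) \<le> ln M"
      using assms \<open>w \<noteq> 0\<close> by simp_all
    then show ?thesis by linarith
  qed
  finally have "norm (Ln w) \<le> \<bar>ln m\<bar> + \<bar>ln M\<bar> + pi" by simp
  then have "norm s * norm (Ln w) \<le> norm s * (\<bar>ln m\<bar> + \<bar>ln M\<bar> + pi)"
    by (rule mult_left_mono) simp
  then have le: "exp (norm (s * Ln w)) \<le> exp (norm s * (\<bar>ln m\<bar> + \<bar>ln M\<bar> + pi))"
    by (simp only: norm_mult exp_le_cancel_iff)
  have "w powr s = exp (s * Ln w)"
    using \<open>w \<noteq> 0\<close> by (simp add: powr_def)
  then show ?thesis
    using order_trans[OF norm_exp le] by (simp only:)
qed

text \<open>With \<open>M = c z + d\<close> the derivative is \<open>M\<^sup>-\<^sup>2\<close>, and \<open>1 / M = a - c (g.z)\<close>. So a bound on \<open>X\<close> bounds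
the derivative from below, and a bound on \<open>g.X\<close> bounds it from above.\<close>

lemma deriv_moebius_bounds:
  assumes "regular_on g X" "bounded X" "bounded (moebius g ` X)"
  obtains m M where "0 < m" "\<And>z. z \<in> X \<Longrightarrow> m \<le> norm (deriv (moebius g) z) \<and> norm (deriv (moebius g) z) \<le> M"
proof -
  obtain a b c d where g: "g = psl2_mat a b c d" and det: "a * d - b * c = 1" by (rule psl2_cases)
  obtain K1 where K1: "K1 > 0" "\<And>z. z \<in> X \<Longrightarrow> norm z \<le> K1"
    using assms(2) by (auto simp: bounded_pos)
  obtain K2 where K2: "K2 > 0" "\<And>z. z \<in> X \<Longrightarrow> norm (moebius g z) \<le> K2"
    using assms(3) by (auto simp: bounded_pos)
  define A where "A = \<bar>c\<bar> * K1 + \<bar>d\<bar> + 1"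
  define C where "C = \<bar>c\<bar> * K2 + \<bar>a\<bar> + 1"
  have AC: "A > 0" "C > 0" using K1(1) K2(1) by (simp_all add: A_def C_def add_nonneg_pos)
  show ?thesis
  proof (rule that)
    show "0 < 1 / A\<^sup>2" using AC by simp
    fix z assume z: "z \<in> X"
    define M where "M = of_real c * z + of_real d"
    have M: "M \<noteq> 0" using assms(1) z by (simp add: M_def g regular_on_psl2_mat[OF det])
    have "moebius g z = (of_real a * z + of_real b) / M"
      by (simp add: g moebius_psl2_mat[OF det] M_def)
    then have "M * moebius g z = of_real a * z + of_real b"
      using M by simp
    moreover have "M * (of_real a - of_real c * moebius g z) = of_real a * M - of_real c * (M * moebius g z)"
      by (simp add: algebra_simps)
    ultimately have "M * (of_real a - of_real c * moebius g z) = of_real a * M - of_real c * (of_real a * z + of_real b)"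
      by (simp only:)
    also have "\<dots> = of_real a * of_real d - of_real b * of_real c"
      by (simp add: M_def algebra_simps)
    finally have "M * (of_real a - of_real c * moebius g z) = 1"
      using det_complex[OF det] by simp
    then have "1 / M = of_real a - of_real c * moebius g z"
      using M by (simp add: field_simps)
    then have "norm (1 / M) \<le> norm (complex_of_real a) + norm (of_real c * moebius g z)"
      by (simp only: norm_triangle_ineq4)
    also have "\<dots> \<le> C"
      using K2 z by (simp add: C_def norm_mult mult_left_mono add_increasing2)
    finally have le_C: "norm (1 / M) \<le> C" .
    have "norm M \<le> norm (of_real c * z) + norm (complex_of_real d)"
      unfolding M_def by (rule norm_triangle_ineq)
    also have "\<dots> \<le> A"
      using K1 z by (simp add: A_def norm_mult mult_left_mono add_increasing2)
    finally have "1 / A \<le> norm (1 / M)"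
      using M AC by (simp add: norm_divide frac_le)
    then have "(1 / A)\<^sup>2 \<le> (norm (1 / M))\<^sup>2"
      using AC by (intro power_mono) auto
    moreover have "(norm (1 / M))\<^sup>2 \<le> C\<^sup>2"
      using le_C by (intro power_mono) auto
    moreover have "norm (deriv (moebius g) z) = (norm (1 / M))\<^sup>2"
      using deriv_moebius_psl2_mat[OF det, of z] M by (simp add: g M_def norm_divide norm_power power_divide)
    ultimately show "1 / A\<^sup>2 \<le> norm (deriv (moebius g) z) \<and> norm (deriv (moebius g) z) \<le> C\<^sup>2"
      by (simp add: power_divide)
  qed
qed

lemma bounded_holomorphic_in_bergman:
  assumes "open D" "bounded D" "f holomorphic_on D" "\<And>z. z \<in> D \<Longrightarrow> norm (f z) \<le> C"
  shows "(\<lambda>z. if z \<in> D then f z else 0) \<in> bergman D"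
proof -
  define F where "F = (\<lambda>z. if z \<in> D then f z else 0)"
  have "F holomorphic_on D"
    using assms(3) by (rule holomorphic_transform) (simp add: F_def)
  moreover have "set_integrable lborel D (\<lambda>z. (cmod (F z))\<^sup>2)"
    unfolding set_integrable_def
  proof (rule integrableI_bounded_set[where A = D and B = "C\<^sup>2"])
    have "continuous_on D (\<lambda>z. (cmod (F z))\<^sup>2)"
      using \<open>F holomorphic_on D\<close> by (intro continuous_intros holomorphic_on_imp_continuous_on)
    then show "(\<lambda>z. indicat_real D z *\<^sub>R (cmod (F z))\<^sup>2) \<in> borel_measurable lborel"
      using borel_measurable_continuous_on_indicator[of D "\<lambda>z. (cmod (F z))\<^sup>2"] assms(1) by simp
    show "emeasure lborel D < \<infinity>"
      using assms(2) by (rule emeasure_bounded_finite)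
    show "AE z in lborel. z \<in> D \<longrightarrow> norm (indicat_real D z *\<^sub>R (cmod (F z))\<^sup>2) \<le> C\<^sup>2"
      using assms(4) by (auto simp: F_def intro!: power_mono)
  qed (use assms(1) in auto)
  ultimately show ?thesis
    by (simp add: bergman_def F_def)
qed

section \<open>Eigenfunctions on one disk\<close>

text \<open>The situation common to both components of the transfer operator: a disk \<open>D\<close> around the repelling
fixed point \<open>p.0\<close> of \<open>g\<close>, away from the attracting fixed point \<open>p.\<infinity>\<close>, with a bounded chart \<open>q\<close>.\<close>

locale repelling_disk =
  fixes l :: real and p q g :: psl2 and D :: "riemann_sphere set" and c r :: real
  assumes l_pos: "l > 0" and r_pos: "r > 0"
    and g: "g = p * a_elem l * inverse p"
    and chart: "psl2_act q ` D = Some ` ball (complex_of_real c) r"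
    and contr: "psl2_act (inverse g) ` (sphere_top closure_of D) \<subseteq> D"
    and repelling: "psl2_act p (Some 0) \<in> D"
    and attracting: "psl2_act p None \<notin> sphere_top closure_of D"
begin

text \<open>The bounded disk \<open>B = q.D\<close> carries the functions. The map \<open>G = (q p)\<^sup>-\<^sup>1\<close> is the coordinate on \<open>B\<close>
that linearizes \<open>h\<close>, the map \<open>g\<^sup>-\<^sup>1\<close> read on \<open>B\<close>, and \<open>U = p\<^sup>-\<^sup>1.D\<close> is its range.\<close>

definition "B = ball (complex_of_real c) r"
definition "G = inverse (q * p)"
definition "h = inverse (q * g * inverse q)"
definition "U = {w. psl2_act p (Some w) \<in> D}"

lemma D_openin: "openin sphere_top D"
proof -
  have "openin sphere_top (psl2_act (inverse q) ` psl2_act q ` D)"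
    unfolding chart by (intro openin_psl2_act_image) simp
  then show ?thesis by (simp add: image_image)
qed

lemma B_props: "open B" "connected B" "bounded B"
  by (simp_all add: B_def)

lemma Some_in_chart: "psl2_act q x \<in> Some ` B \<longleftrightarrow> x \<in> D"
  unfolding B_def chart[symmetric] by (simp add: inj_image_mem_iff[OF inj_psl2_act])

lemma D_ne_infinity: "psl2_act p None \<notin> D"
  using attracting closure_of_subset[of D sphere_top] by auto

lemma G_B:
  assumes "z \<in> B"
  shows "psl2_act G (Some z) = Some (moebius G z)" "moebius G z \<in> U"
proof -
  define x where "x = psl2_act (inverse q) (Some z)"
  have "x \<in> D"
    using assms Some_in_chart[of x] by (simp add: x_def)
  have *: "psl2_act p (psl2_act G (Some z)) = x"
    by (simp add: G_def psl2_inverse_mult psl2_act_mult x_def)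
  then have "psl2_act G (Some z) \<noteq> None"
    using \<open>x \<in> D\<close> D_ne_infinity by metis
  then show "psl2_act G (Some z) = Some (moebius G z)"
    by (rule psl2_act_Some_moebius)
  then show "moebius G z \<in> U"
    using * \<open>x \<in> D\<close> by (simp add: U_def)
qed

lemma K_U:
  assumes "w \<in> U"
  shows "psl2_act (q * p) (Some w) = Some (moebius (q * p) w)" "moebius (q * p) w \<in> B"
proof -
  have "psl2_act (q * p) (Some w) \<in> Some ` B"
    using assms Some_in_chart by (simp add: U_def psl2_act_mult)
  then show "psl2_act (q * p) (Some w) = Some (moebius (q * p) w)" "moebius (q * p) w \<in> B"
    using psl2_act_Some_moebius[of "q * p" w] by auto
qed

lemma G_K: "w \<in> U \<Longrightarrow> moebius G (moebius (q * p) w) = w"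
  using K_U[of w] G_B(1)[of "moebius (q * p) w"] psl2_act_inverse(1)[of "q * p" "Some w"]
  by (simp add: G_def)

lemma K_G: "z \<in> B \<Longrightarrow> moebius (q * p) (moebius G z) = z"
  using G_B[of z] K_U(1)[of "moebius G z"] psl2_act_inverse(2)[of "q * p" "Some z"]
  by (simp add: G_def)

lemma regular: "regular_on G B" "regular_on (q * p) U"
  using G_B(1) K_U(1) by (auto simp: regular_on_def)

lemma scale_U:
  assumes "w \<in> U"
  shows "of_real (exp (- l)) * w \<in> U"
proof -
  have "psl2_act (inverse g) (psl2_act p (Some w)) = psl2_act p (Some (of_real (exp (- l)) * w))"
    by (simp add: g psl2_inverse_mult psl2_act_mult a_elem_inverse a_elem_act)
  moreover have "psl2_act p (Some w) \<in> sphere_top closure_of D"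
    using assms closure_of_subset[of D sphere_top] by (auto simp: U_def)
  ultimately show ?thesis
    using contr by (auto simp: U_def)
qed

lemma h_eq: "h = (q * p) * a_elem (- l) * G" and Gh: "G * h = a_elem (- l) * G"
proof -
  show *: "h = (q * p) * a_elem (- l) * G"
    unfolding h_def G_def by (simp add: g psl2_inverse_mult a_elem_inverse mult.assoc)
  have "G * h = (inverse (q * p) * (q * p)) * (a_elem (- l) * G)"
    unfolding * by (simp only: G_def mult.assoc)
  then show "G * h = a_elem (- l) * G" by simp
qed

lemma h_B:
  assumes "z \<in> B"
  shows "psl2_act h (Some z) = Some (moebius h z)" "moebius h z \<in> B"
    "moebius G (moebius h z) = of_real (exp (- l)) * moebius G z"
    "moebius h z = moebius (q * p) (of_real (exp (- l)) * moebius G z)"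
proof -
  have s: "of_real (exp (- l)) * moebius G z \<in> U"
    using scale_U G_B(2)[OF assms] .
  have "psl2_act h (Some z) = psl2_act (q * p) (psl2_act (a_elem (- l)) (psl2_act G (Some z)))"
    by (simp add: h_eq psl2_act_mult)
  also have "\<dots> = Some (moebius (q * p) (of_real (exp (- l)) * moebius G z))"
    using K_U(1)[OF s] by (simp add: G_B(1)[OF assms] a_elem_act)
  finally have *: "psl2_act h (Some z) = Some (moebius (q * p) (of_real (exp (- l)) * moebius G z))" .
  then show "psl2_act h (Some z) = Some (moebius h z)"
    using psl2_act_Some_moebius[of h z] by simp
  with * show eq: "moebius h z = moebius (q * p) (of_real (exp (- l)) * moebius G z)"
    by simp
  show "moebius h z \<in> B" "moebius G (moebius h z) = of_real (exp (- l)) * moebius G z"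
    unfolding eq using K_U(2)[OF s] G_K[OF s] by simp_all
qed

lemma regular_h: "regular_on h B" "regular_on (G * h) B"
proof -
  show "regular_on h B" using h_B(1) by (simp add: regular_on_def)
  show "regular_on (G * h) B"
    using G_B(1) by (simp add: regular_on_def Gh psl2_act_mult a_elem_act)
qed

text \<open>Since \<open>G h = a\<^sub>-\<^sub>l G\<close> and \<open>a\<^sub>-\<^sub>l\<close> has the constant derivative \<open>e\<^sup>-\<^sup>l\<close>, the weight of \<open>h\<close> is
\<open>e\<^sup>-\<^sup>l\<^sup>s\<close> times a coboundary of the weight of \<open>G\<close>.\<close>

lemma weight_cocycle:
  assumes "z \<in> B"
  shows "deriv (moebius h) z powr s * deriv (moebius G) (moebius h z) powr s =
     exp (- (s * of_real l)) * deriv (moebius G) z powr s"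
proof -
  have reg: "regular_on (a_elem (- l) * G) B"
    using regular_h(2) by (simp add: Gh)
  have "moebius (a_elem (- l)) = (\<lambda>w. of_real (exp (- l)) * w)"
    using psl2_act_Some_moebius[of "a_elem (- l)"] by (simp add: a_elem_act fun_eq_iff)
  then have "deriv (moebius (a_elem (- l))) w = of_real (exp (- l))" for w
    by simp
  then have "deriv (moebius (G * h)) z = of_real (exp (- l)) * deriv (moebius G) z"
    using deriv_moebius_mult[OF regular(1) reg assms B_props(1)] by (simp add: Gh)
  then have "deriv (moebius (G * h)) z powr s = exp (- (s * of_real l)) * deriv (moebius G) z powr s"
    using powr_of_real_pos_mult[of "exp (- l)" "deriv (moebius G) z" s]
      regular_on_has_field_derivative(2)[OF regular(1) assms] by simp
  then show ?thesis
    using deriv_powr_cocycle[OF regular_h[unfolded B_def] regular(1)[unfolded B_def], of z s] h_B(2) assms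
    by (simp add: B_def mult.commute)
qed

text \<open>Boundedness holds because the attracting fixed point, which is \<open>\<infinity>\<close> in this coordinate, is an
exterior point of the disk.\<close>

lemma U_props: "open U" "connected U" "bounded U" "0 \<in> U"
proof -
  have "U = {z. Some z \<in> psl2_act (inverse p) ` D}"
    by (auto simp: U_def psl2_act_image_iff)
  then show "open U"
    using openin_psl2_act_image[OF D_openin, of "inverse p"] by (simp add: openin_sphere_iff)
  show "0 \<in> U" using repelling by (simp add: U_def)
  have "U = moebius G ` B"
  proof
    show "U \<subseteq> moebius G ` B" using G_K K_U(2) by (metis image_eqI subsetI)
  qed (use G_B in auto)
  moreover have "continuous_on B (moebius G)"
    using regular_on_holomorphic[OF regular(1)] by (rule holomorphic_on_imp_continuous_on)
  ultimately show "connected U"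
    using B_props(2) connected_continuous_image by metis
  define V where "V = psl2_act (inverse p) ` (UNIV - sphere_top closure_of D)"
  have "openin sphere_top (UNIV - sphere_top closure_of D)"
    by (metis closedin_closure_of closedin_def topspace_sphere)
  then have "openin sphere_top V"
    unfolding V_def by (rule openin_psl2_act_image)
  moreover have "None \<in> V"
    using attracting by (simp add: V_def psl2_act_image_iff)
  ultimately have "eventually (\<lambda>z. Some z \<in> V) at_infinity"
    by (simp add: openin_sphere_iff)
  then obtain b where b: "\<And>z. norm z \<ge> b \<Longrightarrow> Some z \<in> V"
    by (auto simp: eventually_at_infinity)
  have "norm w \<le> b" if "w \<in> U" for w
  proof (rule ccontr)
    assume "\<not> norm w \<le> b"
    then have "Some w \<in> V" using b by simp
    then show False
      using that closure_of_subset[of D sphere_top] by (auto simp: V_def psl2_act_image_iff U_def)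
  qed
  then show "bounded U" by (auto simp: bounded_iff)
qed

definition "\<phi> s n = (\<lambda>z. if z \<in> B then deriv (moebius G) z powr s * moebius G z ^ n else 0)"

lemma chart_image_eq: "chart_image q D = B"
  by (auto simp: chart_image_def chart B_def)

lemma tau_chart_monomial: "tau_chart s q 1 D p (\<lambda>z. z ^ n) = \<phi> s n"
  unfolding tau_chart_def tau_def chart_image_eq \<phi>_def G_def by (simp cong: if_cong)

lemma tau_chart_g: "tau_chart s q q D g f = (\<lambda>z. if z \<in> B then deriv (moebius h) z powr s * f (moebius h z) else 0)"
  unfolding tau_chart_def tau_def chart_image_eq h_def by (rule refl)

text \<open>Both \<open>B\<close> and \<open>U\<close> are bounded, so the derivative of \<open>G\<close> is bounded and bounded away from zero; the
function is then bounded on the bounded disk \<open>B\<close>.\<close>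

lemma \<phi>_in_H2: "\<phi> s n \<in> H2 q D"
proof -
  have GB: "moebius G ` B \<subseteq> U" using G_B by auto
  then have "bounded (moebius G ` B)" using U_props(3) bounded_subset by blast
  then obtain m M where mM: "0 < m"
      "\<And>z. z \<in> B \<Longrightarrow> m \<le> norm (deriv (moebius G) z) \<and> norm (deriv (moebius G) z) \<le> M"
    using deriv_moebius_bounds[OF regular(1) B_props(3)] by metis
  obtain K where K: "\<And>w. w \<in> U \<Longrightarrow> norm w \<le> K"
    using U_props(3) by (auto simp: bounded_iff)
  define C where "C = exp (norm s * (\<bar>ln m\<bar> + \<bar>ln M\<bar> + pi)) * K ^ n"
  have "norm (deriv (moebius G) z powr s * moebius G z ^ n) \<le> C" if "z \<in> B" for z
    unfolding C_def norm_mult norm_power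
    using that mM K G_B by (intro mult_mono norm_powr_bounded power_mono) auto
  then show ?thesis
    unfolding H2_def chart_image_eq \<phi>_def
    using regular_on_deriv_powr_holomorphic[OF regular(1)[unfolded B_def], of s] regular_on_holomorphic[OF regular(1)]
    by (intro bounded_holomorphic_in_bergman B_props holomorphic_on_mult holomorphic_on_power)
      (simp_all add: B_def)
qed

lemma \<phi>_nonzero: "\<exists>z. \<phi> s n z \<noteq> 0"
proof -
  obtain e where "e > 0" "ball 0 e \<subseteq> U"
    using U_props open_contains_ball by blast
  then have "complex_of_real (e / 2) \<in> U" "complex_of_real (e / 2) \<noteq> 0"
    by (auto simp: dist_norm)
  then obtain w where w: "w \<in> U" "w \<noteq> 0" by blast
  then have "\<phi> s n (moebius (q * p) w) \<noteq> 0"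
    using K_U(2)[OF w(1)] G_K[OF w(1)] regular_on_has_field_derivative(2)[OF regular(1)]
    by (simp add: \<phi>_def)
  then show ?thesis by blast
qed

definition "eigenfunctions s = {f \<in> H2 q D. tau_chart s q q D g f = f}"

lemma bergman_scale: "f \<in> bergman X \<Longrightarrow> (\<lambda>z. k * f z) \<in> bergman X"
  unfolding bergman_def
  by (auto simp: norm_mult power_mult_distrib set_integrable_mult_right intro!: holomorphic_intros)

lemma scaled_\<phi>_eigenfunction:
  assumes "s \<in> resonance_line l n"
  shows "(\<lambda>z. k * \<phi> s n z) \<in> eigenfunctions s"
proof -
  obtain j :: int where s: "s = - of_nat n + 2 * of_real pi * \<i> / of_real l * of_int j"
    using assms by (auto simp: resonance_line_def)
  have "exp (- (s * of_real l)) * of_real (exp (- l)) ^ n = exp (- (s * of_real l) - of_nat n * of_real l)"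
    by (simp add: exp_diff exp_of_nat_mult exp_minus of_real_exp power_inverse divide_inverse flip: exp_of_real)
  also have "- (s * of_real l) - of_nat n * of_real l = of_int (- j) * of_real (2 * pi) * \<i>"
    using l_pos by (simp add: s field_simps)
  also have "exp \<dots> = 1"
    unfolding exp_eq_1 by (auto intro!: exI[of _ "- j"])
  finally have one: "exp (- (s * of_real l)) * of_real (exp (- l)) ^ n = 1" .
  have "tau_chart s q q D g (\<lambda>z. k * \<phi> s n z) = (\<lambda>z. k * \<phi> s n z)"
    unfolding tau_chart_g
  proof (rule ext)
    fix z
    show "(if z \<in> B then deriv (moebius h) z powr s * (k * \<phi> s n (moebius h z)) else 0) = k * \<phi> s n z"
    proof (cases "z \<in> B")
      case True
      have "deriv (moebius h) z powr s * \<phi> s n (moebius h z) =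
         (deriv (moebius h) z powr s * deriv (moebius G) (moebius h z) powr s) * moebius G (moebius h z) ^ n"
        using h_B(2)[OF True] by (simp add: \<phi>_def)
      also have "\<dots> = (exp (- (s * of_real l)) * of_real (exp (- l)) ^ n) * (deriv (moebius G) z powr s * moebius G z ^ n)"
        unfolding weight_cocycle[OF True] h_B(3)[OF True] by (simp add: power_mult_distrib mult_ac)
      also have "\<dots> = \<phi> s n z"
        unfolding one using True by (simp add: \<phi>_def)
      finally show ?thesis using True by (simp add: mult.left_commute)
    qed (simp add: \<phi>_def)
  qed
  then show ?thesis
    using \<phi>_in_H2 bergman_scale by (auto simp: eigenfunctions_def H2_def)
qed

text \<open>Dividing \<open>f\<close> by the weight of \<open>G\<close> and passing to the coordinate \<open>w = G z\<close> gives a function \<open>P\<close> on \<open>U\<close>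
with \<open>P(e\<^sup>-\<^sup>l w) = e\<^sup>l\<^sup>s P(w)\<close>, which is a multiple of a monomial \<open>w\<^sup>n\<close> with \<open>e\<^sup>l\<^sup>s = e\<^sup>-\<^sup>l\<^sup>n\<close>.\<close>

lemma eigenfunction_monomial:
  assumes "f \<in> eigenfunctions s" "f z0 \<noteq> 0"
  obtains n k where "s \<in> resonance_line l n" "f = (\<lambda>z. k * \<phi> s n z)"
proof -
  have f: "f holomorphic_on B" "\<And>z. z \<notin> B \<Longrightarrow> f z = 0"
    using assms(1) by (auto simp: eigenfunctions_def H2_def chart_image_eq bergman_def)
  have "tau_chart s q q D g f = f"
    using assms(1) by (simp add: eigenfunctions_def)
  then have eig: "f z = deriv (moebius h) z powr s * f (moebius h z)" if "z \<in> B" for z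
  proof -
    have "f z = tau_chart s q q D g f z"
      using \<open>tau_chart s q q D g f = f\<close> by simp
    then show ?thesis using that by (simp add: tau_chart_g)
  qed
  have w_nz: "deriv (moebius G) z powr s \<noteq> 0" if "z \<in> B" for z
    using regular_on_has_field_derivative(2)[OF regular(1) that] by simp
  \<comment> \<open>Removing the weight turns the equation for \<open>f\<close> into invariance up to a constant factor.\<close>
  define F where "F = (\<lambda>z. f z / deriv (moebius G) z powr s)"
  define P where "P = (\<lambda>w. F (moebius (q * p) w))"
  have "F holomorphic_on B"
    unfolding F_def using f(1) w_nz regular_on_deriv_powr_holomorphic[OF regular(1)[unfolded B_def], of s]
    by (intro holomorphic_on_divide) (simp_all add: B_def)
  then have P: "P holomorphic_on U"
    unfolding P_def using K_U(2)
    by (intro holomorphic_on_compose_gen[OF regular_on_holomorphic[OF regular(2)], unfolded o_def]) auto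
  have F_h: "F (moebius h z) = exp (s * of_real l) * F z" if "z \<in> B" for z
  proof -
    define a where "a = deriv (moebius h) z powr s"
    define b where "b = deriv (moebius G) (moebius h z) powr s"
    define d where "d = deriv (moebius G) z powr s"
    define e where "e = exp (- (s * of_real l))"
    have ab: "a * b = e * d" and f_eq: "f z = a * f (moebius h z)"
      using weight_cocycle[OF that, of s] eig[OF that] by (simp_all add: a_def b_def d_def e_def)
    have nz: "b \<noteq> 0" "d \<noteq> 0" "e \<noteq> 0"
      using w_nz[OF that] w_nz[OF h_B(2)[OF that]] by (simp_all add: b_def d_def e_def)
    have "exp (s * of_real l) * e = 1"
      by (simp add: e_def flip: exp_add)
    then have inv: "exp (s * of_real l) = 1 / e"
      using nz by (simp add: field_simps)
    have "a \<noteq> 0" using ab nz by auto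
    have "F (moebius h z) = f (moebius h z) / b" by (simp add: F_def b_def)
    also have "\<dots> = (a * f (moebius h z)) / (a * b)" using \<open>a \<noteq> 0\<close> by simp
    also have "\<dots> = f z / (e * d)" by (simp only: ab f_eq)
    also have "\<dots> = exp (s * of_real l) * F z" by (simp add: inv F_def d_def)
    finally show ?thesis .
  qed
  have "P (of_real (exp (- l)) * w) = exp (s * of_real l) * P w" if "w \<in> U" for w
  proof -
    have "moebius (q * p) (of_real (exp (- l)) * w) = moebius h (moebius (q * p) w)"
      using h_B(4)[OF K_U(2)[OF that]] by (simp add: G_K[OF that])
    then show ?thesis
      using F_h[OF K_U(2)[OF that]] by (simp only: P_def)
  qed
  moreover have "z0 \<in> B" using f(2) assms(2) by blast
  then have "moebius G z0 \<in> U" "P (moebius G z0) \<noteq> 0"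
    using G_B(2) w_nz assms(2) K_G by (simp_all add: P_def F_def)
  ultimately obtain n k where n: "exp (s * of_real l) = of_real (exp (- l)) ^ n"
    and k: "\<And>w. w \<in> U \<Longrightarrow> P w = k * w ^ n"
    using scaling_eigenfunction_monomial[OF U_props(1,2,4) _ _ scale_U P] l_pos
    by (metis exp_gt_zero exp_less_one_iff neg_less_0_iff_less)
  have "exp (s * of_real l + of_nat n * of_real l) = exp (s * of_real l) * exp (of_real l) ^ n"
    by (simp add: exp_add exp_of_nat_mult)
  also have "\<dots> = (complex_of_real (exp (- l)) * exp (of_real l)) ^ n"
    by (simp only: n power_mult_distrib)
  also have "complex_of_real (exp (- l)) * exp (of_real l) = 1"
    by (simp add: exp_minus flip: exp_of_real)
  finally have "exp (s * of_real l + of_nat n * of_real l) = 1" by simp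
  then obtain j :: int where "Re (s * of_real l + of_nat n * of_real l) = 0"
     "Im (s * of_real l + of_nat n * of_real l) = of_int (2 * j) * pi"
    by (auto simp: exp_eq_1)
  then have "Re s = - of_nat n" "Im s = 2 * pi / l * of_int j"
    using l_pos by (simp_all add: field_simps) (simp add: distrib_left[symmetric] add_eq_0_iff)?
  then have "s = - of_nat n + of_real (2 * pi / l * of_int j) * \<i>"
    by (simp add: complex_eq_iff)
  then have "s = - of_nat n + 2 * of_real pi * \<i> / of_real l * of_int j"
    by (simp add: mult_ac)
  then have "s \<in> resonance_line l n"
    by (auto simp: resonance_line_def)
  moreover have "f = (\<lambda>z. k * \<phi> s n z)"
  proof
    fix z
    show "f z = k * \<phi> s n z"
    proof (cases "z \<in> B")
      case True
      have "F z = k * moebius G z ^ n"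
        using k[OF G_B(2)[OF True]] K_G[OF True] by (simp add: P_def)
      then show ?thesis
        using w_nz[OF True] True by (simp add: F_def \<phi>_def field_simps)
    qed (simp add: f(2) \<phi>_def)
  qed
  ultimately show ?thesis by (rule that)
qed

end

lemma resonance_line_disjoint:
  assumes "s \<in> resonance_line l n" "s \<in> resonance_line l m"
  shows "n = m"
proof -
  have "Re s = - of_nat k" if "s \<in> resonance_line l k" for k
    using that by (auto simp: resonance_line_def Re_divide)
  from this[OF assms(1)] this[OF assms(2)] show ?thesis by simp
qed

context repelling_disk
begin

lemma eigenfunctions_eq:
  assumes "s \<in> resonance_line l n"
  shows "eigenfunctions s = range (\<lambda>k z. k * \<phi> s n z)"
proof
  show "range (\<lambda>k z. k * \<phi> s n z) \<subseteq> eigenfunctions s"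
    using scaled_\<phi>_eigenfunction[OF assms] by auto
  show "eigenfunctions s \<subseteq> range (\<lambda>k z. k * \<phi> s n z)"
  proof
    fix f assume f: "f \<in> eigenfunctions s"
    show "f \<in> range (\<lambda>k z. k * \<phi> s n z)"
    proof (cases "f = (\<lambda>z. 0 * \<phi> s n z)")
      case False
      then obtain z0 where "f z0 \<noteq> 0" by auto
      then obtain m k where "s \<in> resonance_line l m" "f = (\<lambda>z. k * \<phi> s m z)"
        using eigenfunction_monomial[OF f] by metis
      then show ?thesis
        using resonance_line_disjoint[OF assms] by auto
    qed (rule range_eqI)
  qed
qed

end

section \<open>The transfer operator\<close>

lemma span_coordinate_pair:
  "pairs.span {(f, 0), (0, g)} = range (\<lambda>k z. k * f z) \<times> range (\<lambda>k z. k * g z)"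
proof -
  have "pairs.span {(0 :: complex \<Rightarrow> complex, g)} = range (\<lambda>k. pair_scale k (0, g))"
    by (rule pairs.span_singleton)
  then have "pairs.span {(f, 0), (0, g)} = {x. \<exists>k. x - pair_scale k (f, 0) \<in> range (\<lambda>k. pair_scale k (0, g))}"
    by (simp add: pairs.span_insert)
  also have "\<dots> = {x. \<exists>k m. x = pair_scale m (0, g) + pair_scale k (f, 0)}"
    by (simp add: image_iff diff_eq_eq)
  also have "\<dots> = {x. \<exists>k m. x = ((\<lambda>z. k * f z), (\<lambda>z. m * g z))}"
    by (simp add: pair_scale_def plus_fun_def)
  also have "\<dots> = range (\<lambda>k z. k * f z) \<times> range (\<lambda>k z. k * g z)"
    by auto
  finally show ?thesis .
qed

lemma dim_span_coordinate_pair: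
  assumes "f \<noteq> 0" "g \<noteq> 0"
  shows "pairs.dim (pairs.span {(f, 0), (0, g)}) = 2"
proof -
  have "(f, 0) \<notin> pairs.span {(0, g)}"
    using assms(1) by (auto simp: pairs.span_singleton pair_scale_def prod_eq_iff fun_eq_iff)
  moreover have "pairs.independent {(0, g)}"
    using assms(2) by (simp add: pairs.dependent_single prod_eq_iff)
  ultimately have "pairs.independent {(f, 0), (0, g)}"
    using assms by (simp add: pairs.independent_insert)
  then have "pairs.dim (pairs.span {(f, 0), (0, g)}) = card {(f, 0 :: complex \<Rightarrow> complex), (0, g)}"
    by (rule pairs.dim_span_eq_card_independent)
  also have "\<dots> = 2" using assms by simp
  finally show ?thesis .
qed

theorem theorem1p3:
  fixes l :: real and D1 Dm1 :: "riemann_sphere set" and S1 q1 qm1 :: psl2 and s :: complex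
  assumes "l > 0"
    and "schottky_data l D1 Dm1 S1"
    and "bounded_chart q1 D1" and "bounded_chart qm1 Dm1"
  shows "let H = H_space q1 D1 qm1 Dm1; L = transfer_op s S1 q1 D1 qm1 Dm1 in
    (is_eigenvalue H L 1 \<longleftrightarrow> s \<in> (\<Union>n. resonance_line l n)) \<and>
    (s \<in> (\<Union>n. resonance_line l n) \<longrightarrow> geometric_multiplicity H L 1 = 2) \<and>
    (\<forall>p n. S1 = p * a_elem l * inverse p \<and> s \<in> resonance_line l n \<longrightarrow>
       eigenspace H L 1 = pairs.span
         {(tau_chart s q1 1 D1 p (\<lambda>z. z ^ n), 0),
          (0, tau_chart s qm1 1 Dm1 (p * S_elem) (\<lambda>z. z ^ n))})"
proof -
  define H where "H = H_space q1 D1 qm1 Dm1"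
  define L where "L = transfer_op s S1 q1 D1 qm1 Dm1"
  define \<phi> where "\<phi> = (\<lambda>p n. tau_chart s q1 1 D1 p (\<lambda>z. z ^ n))"
  define \<psi> where "\<psi> = (\<lambda>p n. tau_chart s qm1 1 Dm1 (p * S_elem) (\<lambda>z. z ^ n))"
  note data = assms(2)
  have disks: "real_disk D1" "real_disk Dm1"
    and disj: "(sphere_top closure_of D1) \<inter> (sphere_top closure_of Dm1) = {}"
    and iso: "isometric_quotients S1 (a_elem l)"
    using data by (auto simp: schottky_data_def)
  obtain c1 r1 where chart1: "r1 > 0" "psl2_act q1 ` D1 = Some ` ball (complex_of_real c1) r1"
    using assms(3) real_disk_chart_center_real[OF disks(1)] unfolding bounded_chart_def by metis
  obtain c2 r2 where chart2: "r2 > 0" "psl2_act qm1 ` Dm1 = Some ` ball (complex_of_real c2) r2"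
    using assms(4) real_disk_chart_center_real[OF disks(2)] unfolding bounded_chart_def by metis
  define E1 where "E1 = {f \<in> H2 q1 D1. tau_chart s q1 q1 D1 S1 f = f}"
  define E2 where "E2 = {f \<in> H2 qm1 Dm1. tau_chart s qm1 qm1 Dm1 (inverse S1) f = f}"
  have eig: "eigenspace H L 1 = E1 \<times> E2"
    by (auto simp: eigenspace_def H_def L_def H_space_def transfer_op_def pair_scale_def E1_def E2_def)

  have fixed_points: "psl2_act p (Some 0) \<in> D1" "psl2_act p None \<notin> sphere_top closure_of D1"
      "psl2_act p None \<in> Dm1" "psl2_act p (Some 0) \<notin> sphere_top closure_of Dm1"
    if p: "S1 = p * a_elem l * inverse p" for p
    using schottky_data_fixed_points[OF data p \<open>l > 0\<close>] disj
      closure_of_subset[of D1 sphere_top] closure_of_subset[of Dm1 sphere_top] by auto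
  have disk1: "repelling_disk l p q1 S1 D1 c1 r1" if p: "S1 = p * a_elem l * inverse p" for p
    by unfold_locales (use fixed_points[OF p] chart1 p \<open>l > 0\<close> schottky_data_contracting(2)[OF data] in simp_all)
  have disk2: "repelling_disk l (p * S_elem) qm1 (inverse S1) Dm1 c2 r2" if p: "S1 = p * a_elem l * inverse p" for p
    by (rule repelling_disk.intro[OF \<open>l > 0\<close> chart2(1) conj_inverse_S_elem[OF p] chart2(2)])
      (use fixed_points[OF p] schottky_data_contracting(1)[OF data] in \<open>simp_all add: psl2_act_mult S_elem_act\<close>)

  have span: "eigenspace H L 1 = pairs.span {(\<phi> p n, 0), (0, \<psi> p n)}" "\<phi> p n \<noteq> 0" "\<psi> p n \<noteq> 0"
    if p: "S1 = p * a_elem l * inverse p" and s: "s \<in> resonance_line l n" for p n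
  proof -
    interpret A: repelling_disk l p q1 S1 D1 c1 r1 by (rule disk1[OF p])
    interpret B: repelling_disk l "p * S_elem" qm1 "inverse S1" Dm1 c2 r2 by (rule disk2[OF p])
    have phi: "\<phi> p n = A.\<phi> s n" and psi: "\<psi> p n = B.\<phi> s n"
      unfolding \<phi>_def \<psi>_def by (rule A.tau_chart_monomial, rule B.tau_chart_monomial)
    have "E1 = A.eigenfunctions s" "E2 = B.eigenfunctions s"
      by (simp_all add: E1_def E2_def A.eigenfunctions_def B.eigenfunctions_def)
    then show "eigenspace H L 1 = pairs.span {(\<phi> p n, 0), (0, \<psi> p n)}"
      unfolding eig phi psi span_coordinate_pair using A.eigenfunctions_eq[OF s] B.eigenfunctions_eq[OF s] by simp
    show "\<phi> p n \<noteq> 0" "\<psi> p n \<noteq> 0"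
      unfolding phi psi using A.\<phi>_nonzero[of s n] B.\<phi>_nonzero[of s n] by (auto simp: fun_eq_iff)
  qed

  obtain p0 L0 where L0: "L0 > 0" "S1 = p0 * a_elem L0 * inverse p0"
    using schottky_data_hyperbolic[OF data] .
  \<comment> \<open>The metric of the quotient determines the translation length.\<close>
  have "L0 = l"
    using cylinder_length_unique[OF L0(1) \<open>l > 0\<close> L0(2) iso] .
  then have p0: "S1 = p0 * a_elem l * inverse p0" using L0(2) by simp

  have "s \<in> (\<Union>n. resonance_line l n)" if ev: "is_eigenvalue H L 1"
  proof -
    interpret A: repelling_disk l p0 q1 S1 D1 c1 r1 by (rule disk1[OF p0])
    interpret B: repelling_disk l "p0 * S_elem" qm1 "inverse S1" Dm1 c2 r2 by (rule disk2[OF p0])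
    have "\<exists>F \<in> E1 \<times> E2. F \<noteq> 0"
      using ev by (simp only: is_eigenvalue_def eig)
    then obtain f1 f2 where f12: "f1 \<in> E1" "f2 \<in> E2" "(f1, f2) \<noteq> 0" by blast
    then have f: "f1 \<in> A.eigenfunctions s" "f2 \<in> B.eigenfunctions s"
      by (simp_all only: E1_def E2_def A.eigenfunctions_def B.eigenfunctions_def)
    from f12(3) have "f1 \<noteq> 0 \<or> f2 \<noteq> 0"
      by (simp add: prod_eq_iff)
    then consider z where "f1 z \<noteq> 0" | z where "f2 z \<noteq> 0"
      by (metis ext zero_fun_apply)
    then show ?thesis
    proof cases
      case (1 z)
      then obtain n where "s \<in> resonance_line l n"
        using A.eigenfunction_monomial[OF f(1) 1] by metis
      then show ?thesis by blast
    next
      case (2 z)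
      then obtain n where "s \<in> resonance_line l n"
        using B.eigenfunction_monomial[OF f(2) 2] by metis
      then show ?thesis by blast
    qed
  qed
  moreover have "is_eigenvalue H L 1" if "s \<in> resonance_line l n" for n
    unfolding is_eigenvalue_def span(1)[OF p0 that]
    by (rule bexI[of _ "(\<phi> p0 n, 0)"]) (use span(2)[OF p0 that] in \<open>auto simp: prod_eq_iff intro: pairs.span_base\<close>)
  moreover have "geometric_multiplicity H L 1 = 2" if "s \<in> resonance_line l n" for n
    unfolding geometric_multiplicity_def span(1)[OF p0 that]
    using span(2,3)[OF p0 that] by (rule dim_span_coordinate_pair)
  ultimately show ?thesis
    unfolding Let_def H_def[symmetric] L_def[symmetric]
    using span(1)[unfolded \<phi>_def \<psi>_def] by blast
qed

end
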